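(* Let $G$ be a finite simple graph, and let $v$ be any vertex of $G$. Then (i) $\mathrm{reg}(\mathcal{I}(G))\ge\max\{2,\ \mathrm{reg}(\mathcal{I}(G\setminus\{v\}))\}$; (ii) $\mathrm{pd}(\mathcal{I}(G))\ge\max\{d-1,\ \mathrm{pd}(\mathcal{I}(G\setminus\{v\}))\}$, where $d=\deg v$.
   Context: Graphs are undirected, without loops or multiple edges, not necessarily connected. The vertices of $G$ are identified with the variables of $R=k[x_1,\dots,x_m]$, $k$ an arbitrary field, and $\mathcal{I}(G)=(\{x_ix_j\mid\{x_i,x_j\}\in E_G\})\subseteq R$ is the edge ideal, where $E_G$ is the edge set of $G$; a graph without edges has edge ideal $(0)$. $\deg v$ is the number of edges of $G$ incident to $v$. $G\setminus\{v\}$ is $G$ with $v$ and all edges incident to $v$ deleted. For a homogeneous ideal $I$, $\beta_{i,j}(I)$ denotes the $ij$th graded Betti number of $I$, i.e. the number of copies of $R(-j)$ in the $i$th step of the minimal graded free resolution of $I$ (with $\beta_{0,j}(I)$ counting minimal generators of degree $j$). The regularity is $\mathrm{reg}(I)=\max\{j-i\mid\beta_{i,j}(I)\neq0\}$ and the projective dimension is $\mathrm{pd}(I)=\max\{i\mid\beta_{i,j}(I)\ne0\}$. For any ideal $I$ the convention $\beta_{-1,0}(I)=1$ and $\beta_{-1,j}(I)=0$ for $j\neq0$ is adopted.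
   Formalization: Part (i) is stated only for graphs with at least one edge: for an edgeless graph the edge ideal is (0), whose regularity is 1 under the stated convention (or undefined without it), so the bound reg ≥ 2 fails. *)

theory Defs
  imports "HOL-Library.Poly_Mapping" "Jordan_Normal_Form.Matrix_Kernel"
begin

section \<open>The polynomial ring with variables indexed by a type\<close>

text \<open>For a finite type \<open>'v\<close> with m elements, \<open>('v, 'k) mpoly\<close> is the ring R = k[x_1, ..., x_m]:
  a polynomial is a finitely supported function from exponent vectors to coefficients, and the
  multiplication of \<^type>\<open>poly_mapping\<close> is convolution.\<close>

type_synonym ('v, 'k) mpoly = "('v \<Rightarrow>\<^sub>0 nat) \<Rightarrow>\<^sub>0 'k"

definition X :: "'v \<Rightarrow> ('v, 'k::comm_ring_1) mpoly" where
  "X v = Poly_Mapping.single (Poly_Mapping.single v 1) 1"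

definition total_degree :: "('v \<Rightarrow>\<^sub>0 nat) \<Rightarrow> nat" where
  "total_degree t = (\<Sum>v\<in>Poly_Mapping.keys t. Poly_Mapping.lookup t v)"

text \<open>The zero polynomial is homogeneous of every degree; it is the only homogeneous polynomial of
  negative degree.\<close>

definition homogeneous :: "int \<Rightarrow> ('v, 'k::comm_ring_1) mpoly \<Rightarrow> bool" where
  "homogeneous d p \<longleftrightarrow> (\<forall>t\<in>Poly_Mapping.keys p. int (total_degree t) = d)"

text \<open>An ideal is a submodule of the ring over itself.\<close>

definition ideal_gen :: "'r::comm_ring_1 set \<Rightarrow> 'r set" where
  "ideal_gen S = Modules.module.span (*) S"

definition irrelevant_ideal :: "('v, 'k::comm_ring_1) mpoly set" where
  "irrelevant_ideal = ideal_gen (range X)"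

section \<open>Minimal graded free resolutions and graded Betti numbers\<close>

text \<open>A list \<open>ds\<close> of integers stands for the graded free module that is the direct sum of the
  R(-d), d in \<open>ds\<close>; its elements are the column vectors of length \<open>length ds\<close>, and the basis vector
  number b has degree \<open>ds ! b\<close>. A homomorphism of degree 0 from the module of \<open>ds\<close> to the module of
  \<open>es\<close> is a matrix with homogeneous entries of the following degrees.\<close>

definition graded_matrix :: "int list \<Rightarrow> int list \<Rightarrow> ('v, 'k::comm_ring_1) mpoly mat \<Rightarrow> bool" where
  "graded_matrix ds es A \<longleftrightarrow> A \<in> carrier_mat (length es) (length ds) \<and>
     (\<forall>a<length es. \<forall>b<length ds. homogeneous (ds ! b - es ! a) (A $$ (a, b)))"

definition mat_image :: "'r::comm_ring_1 mat \<Rightarrow> 'r vec set" where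
  "mat_image A = {A *\<^sub>v y | y. y \<in> carrier_vec (dim_col A)}"

text \<open>The resolution is ... \<open>\<rightarrow>\<close> F_2 \<open>\<rightarrow>\<close> F_1 \<open>\<rightarrow>\<close> F_0 \<open>\<rightarrow>\<close> I \<open>\<rightarrow>\<close> 0, where F_i is given by the list
  \<open>D i\<close>, the map F_0 \<open>\<rightarrow>\<close> I sends the basis to the entries of the vector \<open>g\<close>, and \<open>A i\<close> is the matrix
  of F_(i+1) \<open>\<rightarrow>\<close> F_i. Finite length is not required; F_i may be 0. Minimality says that the image
  of F_(i+1) lies in the irrelevant ideal times F_i, for all i.\<close>

definition minimal_graded_free_resolution ::
  "('v, 'k::field) mpoly set \<Rightarrow> (nat \<Rightarrow> int list) \<Rightarrow> ('v, 'k) mpoly vec \<Rightarrow>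
   (nat \<Rightarrow> ('v, 'k) mpoly mat) \<Rightarrow> bool" where
  "minimal_graded_free_resolution I D g A \<longleftrightarrow>
     g \<in> carrier_vec (length (D 0)) \<and>
     (\<forall>b<length (D 0). homogeneous (D 0 ! b) (g $ b)) \<and>
     (\<forall>i. graded_matrix (D (Suc i)) (D i) (A i)) \<and>
     {g \<bullet> y | y. y \<in> carrier_vec (length (D 0))} = I \<and>
     {y \<in> carrier_vec (length (D 0)). g \<bullet> y = 0} = mat_image (A 0) \<and>
     (\<forall>i. mat_kernel (A i) = mat_image (A (Suc i))) \<and>
     (\<forall>i. elements_mat (A i) \<subseteq> irrelevant_ideal)"

text \<open>The value for i = -1 is the convention \<open>\<beta>\<^sub>-\<^sub>1\<^sub>,\<^sub>0(I) = 1\<close>, \<open>\<beta>\<^sub>-\<^sub>1\<^sub>,\<^sub>j(I) = 0\<close> for j different from 0.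
  For i at least 0 the definition is meaningful for homogeneous I: minimal graded free resolutions
  exist and are unique up to isomorphism.\<close>

definition betti :: "('v, 'k::field) mpoly set \<Rightarrow> int \<Rightarrow> int \<Rightarrow> nat" where
  "betti I i j =
     (if i < -1 then 0
      else if i = -1 then (if j = 0 then 1 else 0)
      else (THE n. \<exists>D g A. minimal_graded_free_resolution I D g A \<and> n = count_list (D (nat i)) j))"

text \<open>The index i = -1 is included in the following maxima. This gives the zero ideal regularity 1
  and projective dimension -1. It changes neither value for a nonzero ideal whose elements have no
  terms of degree 0, such as the edge ideal of a graph with an edge.\<close>

definition regularity :: "('v, 'k::field) mpoly set \<Rightarrow> int" where
  "regularity I = Max {j - i | i j. betti I i j \<noteq> 0}"

definition proj_dim :: "('v, 'k::field) mpoly set \<Rightarrow> int" where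
  "proj_dim I = Max {i | i j. betti I i j \<noteq> 0}"

section \<open>Graphs and edge ideals\<close>

text \<open>A graph is a pair of a vertex set and an edge set, an edge being the set of its two ends.\<close>

type_synonym 'v graph = "'v set \<times> 'v set set"

abbreviation verts :: "'v graph \<Rightarrow> 'v set" where "verts \<equiv> fst"
abbreviation edges :: "'v graph \<Rightarrow> 'v set set" where "edges \<equiv> snd"

definition finite_simple_graph :: "'v graph \<Rightarrow> bool" where
  "finite_simple_graph G \<longleftrightarrow> finite (verts G) \<and> (\<forall>e\<in>edges G. e \<subseteq> verts G \<and> card e = 2)"

definition vertex_degree :: "'v graph \<Rightarrow> 'v \<Rightarrow> nat" where
  "vertex_degree G v = card {e \<in> edges G. v \<in> e}"

definition delete_vertex :: "'v graph \<Rightarrow> 'v \<Rightarrow> 'v graph" where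
  "delete_vertex G v = (verts G - {v}, {e \<in> edges G. v \<notin> e})"

text \<open>The vertices of G are among the variables of R, so the edge ideals of G and of G with a
  vertex deleted are ideals of the same ring.\<close>

definition edge_ideal :: "'v graph \<Rightarrow> ('v, 'k::field) mpoly set" where
  "edge_ideal G = ideal_gen {X x * X y | x y. {x, y} \<in> edges G}"

end

theory Submission
  imports Defs "HOL-Library.Function_Algebras"
begin

text \<open>A squarefree monomial ideal has a minimal free resolution graded by sets of variables. Its
  differentials are scalar matrices with monomials put in, and it is exact as soon as, for every set
  S of variables, the scalar complex on the basis elements of degree inside S is exact. Such scalar
  data can be built one homological step at a time by linear algebra. Every differential strictly
  enlarges the degrees, so the resolution is minimal and has finite length. The basis elements
  whose degree avoids v form the resolution belonging to G with v deleted, which bounds all Betti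
  numbers of the latter. An edge occurs as a degree of a generator, so the regularity is at least 2.
  If U is the set of neighbours of v, then the chain map from the Koszul complex on U to the
  resolution that lifts multiplication by v is nonzero on the top basis element even modulo the
  irrelevant ideal, so the resolution does not stop before step d - 1.

  These Betti numbers agree with those of any other minimal graded resolution, because comparison
  maps in both directions compose to maps that are homotopic to the identity, hence equal to it
  modulo the irrelevant ideal.\<close>

section \<open>Homogeneous components and lifting\<close>

text \<open>The strand of a squarefree resolution in a multidegree w depends only on the support of
  w, so exactness over the polynomial ring reduces to finitely many finite-dimensional complexes,
  one for each set of variables. This indexing also turns deletion of v into an operation on the
  resolution itself. As \<open>betti\<close> is a definite description, evaluating it takes both
  existence and uniqueness of minimal resolutions; as \<open>Max\<close> says nothing about infinite
  sets, finite length is needed before maxima can be compared. The Koszul complex enters because v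
  times the ideal generated by U lies in the edge ideal, so multiplication by v maps R/(U) to R/I.
  That the lift survives at the top rests on squeezing: a basis element occurring there has degree
  inside the union of U and {v}, and strict growth of degrees along the differential forces it to be
  that whole set.\<close>

abbreviation constant_coeff :: "('v, 'k::zero) mpoly \<Rightarrow> 'k" where
  "constant_coeff p \<equiv> Poly_Mapping.lookup p 0"

lemma keys_multE:
  assumes "t \<in> Poly_Mapping.keys (p * q)"
  obtains a b where "a \<in> Poly_Mapping.keys p" "b \<in> Poly_Mapping.keys q" "t = a + b"
  using assms keys_mult[of p q] by blast

lemma total_degree_add:
  "total_degree (s + t :: 'v::finite \<Rightarrow>\<^sub>0 nat) = total_degree s + total_degree t"
proof -
  have "total_degree u = (\<Sum>v\<in>UNIV. Poly_Mapping.lookup u v)" for u :: "'v \<Rightarrow>\<^sub>0 nat"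
    unfolding total_degree_def by (rule sum.mono_neutral_left) (auto simp: in_keys_iff)
  then show ?thesis
    by (simp add: lookup_add sum.distrib)
qed

lemma lookup_single_mult:
  fixes s :: "'v \<Rightarrow>\<^sub>0 nat"
  shows "Poly_Mapping.lookup (Poly_Mapping.single s c * q) (s + u) = c * Poly_Mapping.lookup q u"
  by (simp add: lookup_mult lookup_single Sum_any_right_distrib[symmetric] when_mult)

text \<open>Constant terms are residues modulo the irrelevant ideal. Multiplicativity rests on
  exponents being natural numbers: the exponent 0 splits only as 0 + 0.\<close>

lemma constant_coeff_mult:
  fixes p q :: "('v, 'k::comm_ring_1) mpoly"
  shows "constant_coeff (p * q) = constant_coeff p * constant_coeff q"
proof -
  define p' where "p' = p - Poly_Mapping.single 0 (constant_coeff p)"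
  have "0 \<notin> Poly_Mapping.keys (p' * q)"
  proof
    assume "0 \<in> Poly_Mapping.keys (p' * q)"
    then obtain a b where ab: "a \<in> Poly_Mapping.keys p'" "0 = a + b"
      by (rule keys_multE)
    have "a = 0"
      by (rule poly_mapping_eqI) (metis ab(2) add_eq_0_iff_both_eq_0 lookup_add lookup_zero)
    then show False
      using ab(1) by (simp add: p'_def in_keys_iff lookup_minus)
  qed
  then have "constant_coeff (p' * q) = 0"
    by (simp add: in_keys_iff)
  moreover have "p * q = Poly_Mapping.single 0 (constant_coeff p) * q + p' * q"
    by (simp add: p'_def algebra_simps)
  ultimately show ?thesis
    using lookup_single_mult[of 0 "constant_coeff p" q 0] by (simp add: lookup_add)
qed

lemma module_mult: "Modules.module ((*) :: 'r::comm_ring_1 \<Rightarrow> 'r \<Rightarrow> 'r)"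
  by standard (simp_all add: algebra_simps)

lemma irrelevant_ideal_constant_coeff:
  assumes "p \<in> (irrelevant_ideal :: ('v, 'k::comm_ring_1) mpoly set)"
  shows "constant_coeff p = 0"
proof -
  interpret Modules.module "(*) :: ('v, 'k) mpoly \<Rightarrow> _"
    by (rule module_mult)
  have "range (X :: _ \<Rightarrow> ('v, 'k) mpoly) \<subseteq> {p. constant_coeff p = 0}"
    by (auto simp: X_def lookup_single when_def)
      (metis lookup_single_eq lookup_zero nat.simps(3))
  moreover have "subspace {p :: ('v, 'k) mpoly. constant_coeff p = 0}"
    by (auto simp: subspace_def lookup_add constant_coeff_mult)
  ultimately have "irrelevant_ideal \<subseteq> {p :: ('v, 'k) mpoly. constant_coeff p = 0}"
    unfolding irrelevant_ideal_def ideal_gen_def by (rule span_minimal)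
  then show ?thesis
    using assms by blast
qed

definition hom_part :: "int \<Rightarrow> ('v, 'k::comm_ring_1) mpoly \<Rightarrow> ('v, 'k) mpoly" where
  "hom_part d p = (\<Sum>t\<in>{t \<in> Poly_Mapping.keys p. int (total_degree t) = d}.
     Poly_Mapping.single t (Poly_Mapping.lookup p t))"

lemma lookup_hom_part:
  "Poly_Mapping.lookup (hom_part d p) t =
     (if int (total_degree t) = d then Poly_Mapping.lookup p t else 0)"
  unfolding hom_part_def lookup_sum lookup_single when_def
  by (simp add: sum.delta' in_keys_iff)

lemma homogeneous_hom_part: "homogeneous d (hom_part d p)"
  by (auto simp: homogeneous_def in_keys_iff lookup_hom_part split: if_splits)

lemma hom_part_sum: "hom_part d (\<Sum>a\<in>A. f a) = (\<Sum>a\<in>A. hom_part d (f a))"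
  by (rule poly_mapping_eqI) (simp add: lookup_hom_part lookup_sum)

lemma hom_part_homogeneous: "homogeneous d p \<Longrightarrow> hom_part d p = p"
  by (rule poly_mapping_eqI) (auto simp: lookup_hom_part homogeneous_def in_keys_iff)

lemma homogeneous_mult:
  fixes p q :: "('v::finite, 'k::comm_ring_1) mpoly"
  assumes "homogeneous d p" "homogeneous e q"
  shows "homogeneous (d + e) (p * q)"
  using assms unfolding homogeneous_def by (auto elim!: keys_multE simp: total_degree_add)

lemma homogeneous_sum: "(\<And>a. a \<in> A \<Longrightarrow> homogeneous d (f a)) \<Longrightarrow> homogeneous d (\<Sum>a\<in>A. f a)"
  using keys_sum[of f A] unfolding homogeneous_def by blast

text \<open>Multiplication by a homogeneous element of degree e shifts the grading by e, so what
  \<open>y\<close> has outside degree d - e contributes nothing in degree d.\<close>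

lemma hom_part_mult:
  fixes a y :: "('v::finite, 'k::comm_ring_1) mpoly"
  assumes "homogeneous e a"
  shows "hom_part d (a * y) = a * hom_part (d - e) y"
proof -
  define r where "r = y - hom_part (d - e) y"
  have "hom_part d (a * r) = 0"
  proof (rule poly_mapping_eqI)
    fix t
    have False if deg: "int (total_degree t) = d" and t: "t \<in> Poly_Mapping.keys (a * r)"
    proof -
      obtain s u where "s \<in> Poly_Mapping.keys a" "u \<in> Poly_Mapping.keys r" "t = s + u"
        using t by (rule keys_multE)
      with deg assms show False
        by (auto simp: homogeneous_def total_degree_add r_def in_keys_iff lookup_minus
            lookup_hom_part split: if_splits)
    qed
    then show "Poly_Mapping.lookup (hom_part d (a * r)) t = Poly_Mapping.lookup 0 t"
      by (auto simp: lookup_hom_part in_keys_iff)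
  qed
  moreover have "a * y = a * hom_part (d - e) y + a * r"
    by (simp add: r_def algebra_simps)
  moreover have "hom_part d (p + q) = hom_part d p + hom_part d q" for p q :: "('v, 'k) mpoly"
    by (rule poly_mapping_eqI) (simp add: lookup_hom_part lookup_add)
  moreover have "homogeneous d (a * hom_part (d - e) y)"
    using homogeneous_mult[OF assms homogeneous_hom_part, of "d - e" y] by simp
  ultimately show ?thesis
    by (simp add: hom_part_homogeneous)
qed

section \<open>Graded matrices and factorization through a differential\<close>

lemma index_mult_mat_sum:
  "A \<in> carrier_mat m n \<Longrightarrow> B \<in> carrier_mat n k \<Longrightarrow> i < m \<Longrightarrow> j < k \<Longrightarrow>
   (A * B) $$ (i, j) = (\<Sum>l<n. A $$ (i, l) * B $$ (l, j))"
  by (auto simp: scalar_prod_def atLeast0LessThan intro!: sum.cong)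

lemma graded_matrix_carrier: "graded_matrix ds es A \<Longrightarrow> A \<in> carrier_mat (length es) (length ds)"
  by (simp add: graded_matrix_def)

lemma graded_matrix_mult:
  fixes A B :: "('v::finite, 'k::comm_ring_1) mpoly mat"
  assumes A: "graded_matrix ds es A" and B: "graded_matrix cs ds B"
  shows "graded_matrix cs es (A * B)"
  unfolding graded_matrix_def
proof (intro conjI allI impI)
  show "A * B \<in> carrier_mat (length es) (length cs)"
    using A B by (auto dest!: graded_matrix_carrier)
  fix a b assume "a < length es" "b < length cs"
  moreover have "homogeneous (cs ! b - es ! a) (A $$ (a, l) * B $$ (l, b))" if "l < length ds" for l
    using A B that calculation
      homogeneous_mult[of "ds ! l - es ! a" "A $$ (a, l)" "cs ! b - ds ! l" "B $$ (l, b)"]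
    by (simp add: graded_matrix_def)
  ultimately show "homogeneous (cs ! b - es ! a) ((A * B) $$ (a, b))"
    by (subst index_mult_mat_sum[OF graded_matrix_carrier[OF A] graded_matrix_carrier[OF B]])
      (auto intro: homogeneous_sum)
qed

lemma mat_lift:
  fixes A B :: "'r::comm_ring_1 mat"
  assumes A: "A \<in> carrier_mat m n" and B: "B \<in> carrier_mat m k"
    and im: "\<And>j. j < k \<Longrightarrow> col B j \<in> mat_image A"
  obtains C where "C \<in> carrier_mat n k" "A * C = B"
proof -
  have "\<forall>j<k. \<exists>y. y \<in> carrier_vec n \<and> A *\<^sub>v y = col B j"
    using im A unfolding mat_image_def by fastforce
  then obtain y where y: "\<And>j. j < k \<Longrightarrow> y j \<in> carrier_vec n"
    "\<And>j. j < k \<Longrightarrow> A *\<^sub>v y j = col B j"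
    by metis
  define C where "C = mat n k (\<lambda>(i, j). y j $ i)"
  have C: "C \<in> carrier_mat n k"
    by (simp add: C_def)
  have col: "col C j = y j" if "j < k" for j
    using y(1)[OF that] that by (intro eq_vecI) (auto simp: C_def)
  have "A * C = B"
  proof (rule eq_matI)
    fix i j assume ij: "i < dim_row B" "j < dim_col B"
    then have "(A * C) $$ (i, j) = (A *\<^sub>v y j) $ i"
      using A B C by (simp add: col)
    then show "(A * C) $$ (i, j) = B $$ (i, j)"
      using ij B by (simp add: y(2))
  qed (use A B C in auto)
  with C show thesis
    by (rule that)
qed

text \<open>A lift chosen without regard to degrees can be corrected afterwards: as \<open>A\<close>
  and \<open>B\<close> are homogeneous, replacing each entry of the lift by its component of the
  required degree does not change the product.\<close>

lemma graded_mat_lift: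
  fixes A B :: "('v::finite, 'k::comm_ring_1) mpoly mat"
  assumes A: "graded_matrix ds es A" and B: "graded_matrix cs es B"
    and im: "\<And>j. j < length cs \<Longrightarrow> col B j \<in> mat_image A"
  obtains C where "graded_matrix cs ds C" "A * C = B"
proof -
  note cA = graded_matrix_carrier[OF A] and cB = graded_matrix_carrier[OF B]
  obtain Y where Y: "Y \<in> carrier_mat (length ds) (length cs)" "A * Y = B"
    using mat_lift[OF cA cB im] by blast
  define C where "C = mat (length ds) (length cs) (\<lambda>(i, j). hom_part (cs ! j - ds ! i) (Y $$ (i, j)))"
  have C: "graded_matrix cs ds C"
    by (auto simp: C_def graded_matrix_def homogeneous_hom_part)
  have "A * C = B"
  proof (rule eq_matI)
    fix i j assume "i < dim_row B" "j < dim_col B"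
    then have ij: "i < length es" "j < length cs"
      using cB by auto
    have "B $$ (i, j) = hom_part (cs ! j - es ! i) (B $$ (i, j))"
      using B ij by (simp add: hom_part_homogeneous graded_matrix_def)
    also have "\<dots> = hom_part (cs ! j - es ! i) (\<Sum>l<length ds. A $$ (i, l) * Y $$ (l, j))"
      unfolding Y(2)[symmetric] by (subst index_mult_mat_sum[OF cA Y(1) ij]) simp
    also have "\<dots> = (\<Sum>l<length ds. A $$ (i, l) * C $$ (l, j))"
      unfolding hom_part_sum
    proof (rule sum.cong)
      fix l assume "l \<in> {..<length ds}"
      then have "homogeneous (ds ! l - es ! i) (A $$ (i, l))"
        using A ij by (simp add: graded_matrix_def)
      from hom_part_mult[OF this, of "cs ! j - es ! i" "Y $$ (l, j)"] \<open>l \<in> _\<close> ij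
      show "hom_part (cs ! j - es ! i) (A $$ (i, l) * Y $$ (l, j)) = A $$ (i, l) * C $$ (l, j)"
        by (simp add: C_def)
    qed simp
    also have "\<dots> = (A * C) $$ (i, j)"
      by (subst index_mult_mat_sum[OF cA graded_matrix_carrier[OF C] ij]) simp
    finally show "(A * C) $$ (i, j) = B $$ (i, j)"
      by simp
  qed (use cA cB graded_matrix_carrier[OF C] in auto)
  with C show thesis
    by (rule that)
qed

lemma col_mult_in_kernel:
  assumes A: "A \<in> carrier_mat m n" and B: "B \<in> carrier_mat n k" and 0: "A * B = 0\<^sub>m m k"
    and j: "j < k"
  shows "col B j \<in> mat_kernel A"
proof -
  have "A *\<^sub>v col B j = col (A * B) j"
    using A B j by (intro eq_vecI) auto
  also have "\<dots> = 0\<^sub>v m"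
    using j by (simp add: 0)
  finally show ?thesis
    using A B by (intro mat_kernelI) auto
qed

lemma mult_eq_0_of_kernel_eq_image:
  assumes A: "A \<in> carrier_mat m n" and B: "B \<in> carrier_mat n k"
    and "mat_kernel A = mat_image B"
  shows "A * B = 0\<^sub>m m k"
proof (rule eq_matI)
  fix i j assume ij: "i < dim_row (0\<^sub>m m k)" "j < dim_col (0\<^sub>m m k)"
  have "col B j = B *\<^sub>v unit_vec k j"
    using ij B by (intro eq_vecI) auto
  then have "col B j \<in> mat_image B"
    using B unfolding mat_image_def by auto
  then have "A *\<^sub>v col B j = 0\<^sub>v m"
    using assms by (auto dest: mat_kernelD)
  then have "(A *\<^sub>v col B j) $ i = 0"
    using ij by simp
  then show "(A * B) $$ (i, j) = 0\<^sub>m m k $$ (i, j)"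
    using ij A B by simp
qed (use A B in auto)

section \<open>Uniqueness of graded Betti numbers\<close>

text \<open>The augmentation F_0 \<open>\<rightarrow>\<close> I \<open>\<subseteq>\<close> R is made the map with index 0, so that all indices are shifted
  by one and \<open>E 0 = [0]\<close> is R itself.\<close>

definition augmented_resolution ::
  "('v, 'k::field) mpoly set \<Rightarrow> (nat \<Rightarrow> int list) \<Rightarrow> (nat \<Rightarrow> ('v, 'k) mpoly mat) \<Rightarrow> bool" where
  "augmented_resolution I E M \<longleftrightarrow>
     E 0 = [0] \<and>
     (\<forall>i. graded_matrix (E (Suc i)) (E i) (M i)) \<and>
     mat_image (M 0) = {y \<in> carrier_vec 1. y $ 0 \<in> I} \<and>
     (\<forall>i. mat_kernel (M i) = mat_image (M (Suc i))) \<and>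
     (\<forall>i. \<forall>p\<in>elements_mat (M (Suc i)). constant_coeff p = 0)"

text \<open>The vanishing of constant terms starts one step after the augmentation, whose entries
  may be units, as they are for I = R.\<close>

lemma augmented_resolution_minimal:
  assumes "minimal_graded_free_resolution I D g A"
  shows "augmented_resolution I (case_nat [0] D)
           (case_nat (mat 1 (length (D 0)) (\<lambda>(_, b). g $ b)) A)"
proof -
  let ?n = "length (D 0)"
  define G where "G = mat 1 ?n (\<lambda>(_, b). g $ b)"
  note r = assms[unfolded minimal_graded_free_resolution_def]
  have vec_g: "vec ?n (($) g) = g"
    using r by (intro eq_vecI) auto
  have mult: "G *\<^sub>v y = vec 1 (\<lambda>_. g \<bullet> y)" for y
    by (intro eq_vecI) (auto simp: G_def vec_g)
  have [simp]: "dim_col G = ?n" "dim_row G = 1"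
    by (simp_all add: G_def)
  have "mat_image G = {y \<in> carrier_vec 1. y $ 0 \<in> I}"
  proof (intro equalityI subsetI)
    fix z assume "z \<in> mat_image G"
    then show "z \<in> {y \<in> carrier_vec 1. y $ 0 \<in> I}"
      using r by (force simp: mat_image_def mult)
  next
    fix z assume z: "z \<in> {y \<in> carrier_vec 1. y $ 0 \<in> I}"
    then obtain y where "y \<in> carrier_vec ?n" "z $ 0 = g \<bullet> y"
      using r by blast
    moreover have "z = vec 1 (\<lambda>_. z $ 0)"
      using z by (intro eq_vecI) auto
    ultimately show "z \<in> mat_image G"
      by (auto simp: mat_image_def mult)
  qed
  moreover have "mat_kernel G = mat_image (A 0)"
  proof -
    have "vec 1 (\<lambda>_. c) = 0\<^sub>v 1 \<longleftrightarrow> c = 0" for c :: "('a, 'b) mpoly"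
      by (auto simp: vec_eq_iff)
    then show ?thesis
      using r by (simp add: mat_kernel_def mult del: One_nat_def)
  qed
  ultimately show ?thesis
    using r unfolding augmented_resolution_def G_def[symmetric]
    by (auto simp: graded_matrix_def G_def irrelevant_ideal_constant_coeff subset_iff split: nat.split)
qed

lemma augmented_resolution_carrier:
  assumes "augmented_resolution I E M"
  shows "M i \<in> carrier_mat (length (E i)) (length (E (Suc i)))"
  using assms by (auto simp: augmented_resolution_def intro: graded_matrix_carrier)

lemma augmented_resolution_comp:
  assumes "augmented_resolution I E M"
  shows "M i * M (Suc i) = 0\<^sub>m (length (E i)) (length (E (Suc (Suc i))))"
  using assms augmented_resolution_carrier[OF assms]
  by (intro mult_eq_0_of_kernel_eq_image) (auto simp: augmented_resolution_def)

text \<open>The comparison theorem for resolutions. The lifts are kept of degree 0, so that later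
  their constant terms can link only generators of equal degree.\<close>

lemma resolution_comparison:
  fixes I :: "('v::finite, 'k::field) mpoly set"
  assumes r: "augmented_resolution I E M" and r': "augmented_resolution I E' M'"
  obtains P where "P 0 = 1\<^sub>m 1" "\<And>i. graded_matrix (E i) (E' i) (P i)"
    "\<And>i. M' i * P (Suc i) = P i * M i"
proof -
  note c = augmented_resolution_carrier[OF r] and c' = augmented_resolution_carrier[OF r']
  \<comment> \<open>The invariant for dependent choice: the next map exists once the columns of
    \<open>X * M i\<close> lie in the image of \<open>M' i\<close>. For i = 0 both images are I;
    afterwards the columns are cycles, and \<open>M'\<close> is exact.\<close>
  define liftable where "liftable i X \<longleftrightarrow> graded_matrix (E i) (E' i) X \<and> (i = 0 \<longrightarrow> X = 1\<^sub>m 1) \<and>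
    (\<forall>j<length (E (Suc i)). col (X * M i) j \<in> mat_image (M' i))" for i X
  have grM: "graded_matrix (E (Suc i)) (E i) (M i)" for i
    using r by (simp add: augmented_resolution_def)
  have E0: "E 0 = [0]" "E' 0 = [0]"
    using r r' by (auto simp: augmented_resolution_def)
  have "\<exists>P. \<forall>i. liftable i (P i) \<and> M' i * P (Suc i) = P i * M i"
  proof (rule dependent_nat_choice)
    have cM0: "M 0 \<in> carrier_mat 1 (length (E (Suc 0)))"
      using c[of 0] E0 by simp
    have "col (1\<^sub>m 1 * M 0) j \<in> mat_image (M' 0)" if "j < length (E (Suc 0))" for j
    proof -
      have "mat_image (M' 0) = mat_image (M 0)"
        using r r' by (simp add: augmented_resolution_def)
      moreover have "col (M 0) j = M 0 *\<^sub>v unit_vec (length (E (Suc 0))) j"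
        using that cM0 by (intro eq_vecI) auto
      moreover have "1\<^sub>m 1 * M 0 = M 0"
        using cM0 by simp
      ultimately show ?thesis
        using cM0 by (auto simp: mat_image_def)
    qed
    moreover have "graded_matrix [0] [0] (1\<^sub>m 1 :: ('v, 'k) mpoly mat)"
      by (auto simp: graded_matrix_def homogeneous_def total_degree_def)
    ultimately show "\<exists>X. liftable 0 X"
      by (auto simp: liftable_def E0 simp del: One_nat_def)
  next
    fix i X assume X: "liftable i X"
    then have gX: "graded_matrix (E i) (E' i) X"
      by (simp add: liftable_def)
    note cX = graded_matrix_carrier[OF gX]
    have gr: "graded_matrix (E' (Suc i)) (E' i) (M' i)"
      using r' by (simp add: augmented_resolution_def)
    obtain Y where Y: "graded_matrix (E (Suc i)) (E' (Suc i)) Y" "M' i * Y = X * M i"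
      using graded_mat_lift[OF gr graded_matrix_mult[OF gX grM]] X
      by (auto simp: liftable_def)
    note cY = graded_matrix_carrier[OF Y(1)]
    have "M' i * (Y * M (Suc i)) = (M' i * Y) * M (Suc i)"
      using c[of "Suc i"] c'[of i] cY by simp
    also have "\<dots> = X * (M i * M (Suc i))"
      using c[of i] c[of "Suc i"] cX by (simp add: Y(2))
    also have "\<dots> = 0\<^sub>m (length (E' i)) (length (E (Suc (Suc i))))"
      using cX by (simp add: augmented_resolution_comp[OF r])
    finally have "col (Y * M (Suc i)) j \<in> mat_kernel (M' i)" if "j < length (E (Suc (Suc i)))" for j
      using col_mult_in_kernel[OF c' _ _ that] mult_carrier_mat[OF cY c] by blast
    then have "liftable (Suc i) Y"
      using Y r' by (simp add: liftable_def augmented_resolution_def)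
    with Y show "\<exists>Y. liftable (Suc i) Y \<and> M' i * Y = X * M i"
      by blast
  qed
  then show thesis
    using that by (auto simp: liftable_def)
qed

text \<open>As \<open>T\<close> lifts the identity of R, \<open>1 - T\<close> is null-homotopic by a homotopy that vanishes in
  step 0. The differentials in the remaining steps have no constant terms, so \<open>1 - T\<close> has none
  either.\<close>

lemma chain_endomorphism_constant_coeff:
  fixes I :: "('v::finite, 'k::field) mpoly set"
  assumes r: "augmented_resolution I E M"
    and T0: "T 0 = 1\<^sub>m 1" and cT: "\<And>i. T i \<in> carrier_mat (length (E i)) (length (E i))"
    and chain: "\<And>i. M i * T (Suc i) = T i * M i"
    and ab: "a < length (E i)" "b < length (E i)"
  shows "constant_coeff (T i $$ (a, b)) = (if a = b then 1 else 0)"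
proof -
  note c = augmented_resolution_carrier[OF r]
  define d where "d i = 1\<^sub>m (length (E i)) - T i" for i
  have cd: "d i \<in> carrier_mat (length (E i)) (length (E i))" for i
    using cT by (simp add: d_def minus_carrier_mat)
  have E0: "E 0 = [0]"
    using r by (simp add: augmented_resolution_def)
  have chain_d: "M i * d (Suc i) = d i * M i" for i
    unfolding d_def
    by (subst mult_minus_distrib_mat[OF c _ cT], simp)
      (subst minus_mult_distrib_mat[OF _ cT c], use c[of i] chain in simp_all)
  have d0: "d 0 = 0\<^sub>m 1 1"
    by (rule eq_matI) (auto simp: d_def T0 E0)
  \<comment> \<open>The homotopy must satisfy
    \<open>d (Suc i) = M (Suc i) * h (Suc i) + h i * M i\<close>. The next choice is possible
    because the columns of \<open>d (Suc i) - h * M i\<close> are cycles.\<close>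
  define liftable where "liftable i h \<longleftrightarrow> h \<in> carrier_mat (length (E (Suc i))) (length (E i)) \<and>
    (i = 0 \<longrightarrow> h = 0\<^sub>m (length (E (Suc 0))) 1) \<and>
    M i * (d (Suc i) - h * M i) = 0\<^sub>m (length (E i)) (length (E (Suc i)))" for i h
  have "\<exists>h. \<forall>i. liftable i (h i) \<and> M (Suc i) * h (Suc i) = d (Suc i) - h i * M i"
  proof (rule dependent_nat_choice)
    have c0: "M 0 \<in> carrier_mat 1 (length (E (Suc 0)))"
      using c[of 0] E0 by simp
    have "0\<^sub>m (length (E (Suc 0))) 1 * M 0 = 0\<^sub>m (length (E (Suc 0))) (length (E (Suc 0)))"
      using c0 by simp
    moreover have "d (Suc 0) - 0\<^sub>m (length (E (Suc 0))) (length (E (Suc 0))) = d (Suc 0)"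
      using cd[of "Suc 0"] by (intro eq_matI) auto
    ultimately have "liftable 0 (0\<^sub>m (length (E (Suc 0))) 1)"
      using c0 chain_d[of 0] by (auto simp: liftable_def E0 d0 simp del: One_nat_def)
    then show "\<exists>h. liftable 0 h"
      by blast
  next
    fix i h assume h: "liftable i h"
    then have ch: "h \<in> carrier_mat (length (E (Suc i))) (length (E i))"
      by (simp add: liftable_def)
    let ?B = "d (Suc i) - h * M i"
    have cB: "?B \<in> carrier_mat (length (E (Suc i))) (length (E (Suc i)))"
      using ch c[of i] by (intro minus_carrier_mat mult_carrier_mat) auto
    have "col ?B j \<in> mat_image (M (Suc i))" if "j < length (E (Suc i))" for j
      using col_mult_in_kernel[OF c cB _ that] h r
      by (auto simp: liftable_def augmented_resolution_def)
    then obtain H where H: "H \<in> carrier_mat (length (E (Suc (Suc i)))) (length (E (Suc i)))"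
      "M (Suc i) * H = ?B"
      using mat_lift[OF c cB] by blast
    have cHM: "H * M (Suc i) \<in> carrier_mat (length (E (Suc (Suc i)))) (length (E (Suc (Suc i))))"
      by (rule mult_carrier_mat[OF H(1) c])
    have chM: "h * M i \<in> carrier_mat (length (E (Suc i))) (length (E (Suc i)))"
      by (rule mult_carrier_mat[OF ch c])
    have "M (Suc i) * (d (Suc (Suc i)) - H * M (Suc i)) =
      d (Suc i) * M (Suc i) - M (Suc i) * (H * M (Suc i))"
      by (subst mult_minus_distrib_mat[OF c cd cHM]) (simp add: chain_d)
    also have "M (Suc i) * (H * M (Suc i)) = ?B * M (Suc i)"
      using assoc_mult_mat[OF c H(1) c] by (simp add: H(2))
    also have "\<dots> = d (Suc i) * M (Suc i) - h * M i * M (Suc i)"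
      by (rule minus_mult_distrib_mat[OF cd chM c])
    also have "h * M i * M (Suc i) = h * (M i * M (Suc i))"
      by (rule assoc_mult_mat[OF ch c c])
    also have "\<dots> = 0\<^sub>m (length (E (Suc i))) (length (E (Suc (Suc i))))"
      using ch by (simp add: augmented_resolution_comp[OF r])
    finally have "M (Suc i) * (d (Suc (Suc i)) - H * M (Suc i)) =
        0\<^sub>m (length (E (Suc i))) (length (E (Suc (Suc i))))"
      using mult_carrier_mat[OF cd c, of "Suc i"] by (auto simp: mat_eq_iff)
    with H show "\<exists>H. liftable (Suc i) H \<and> M (Suc i) * H = ?B"
      by (auto simp: liftable_def)
  qed
  then obtain h where h: "\<And>i. liftable i (h i)" "\<And>i. M (Suc i) * h (Suc i) = d (Suc i) - h i * M i"
    by blast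
  have ch: "h i \<in> carrier_mat (length (E (Suc i))) (length (E i))" for i
    using h(1)[of i] by (simp add: liftable_def)
  have cc: "constant_coeff (M (Suc i) $$ (a, b)) = 0"
    if "a < length (E (Suc i))" "b < length (E (Suc (Suc i)))" for i a b
    using r that c[of "Suc i"] elements_matI[OF c that refl]
    by (auto simp: augmented_resolution_def)
  show ?thesis
  proof (cases i)
    case 0
    then show ?thesis
      using ab E0 by (auto simp: T0)
  next
    case (Suc l)
    have "constant_coeff ((M i * h i) $$ (a, b)) = 0"
      using ab cc[of a l] Suc
      by (subst index_mult_mat_sum[OF c ch]) (auto simp: lookup_sum constant_coeff_mult)
    \<comment> \<open>For l > 0 the factor \<open>M l\<close> has no constant terms. For l = 0 it is
      the augmentation, which may have some, and the vanishing of \<open>h 0\<close> takes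
      over.\<close>
    moreover have "constant_coeff ((h l * M l) $$ (a, b)) = 0"
    proof (cases l)
      case 0
      then have "h l = 0\<^sub>m (length (E (Suc 0))) 1"
        using h(1)[of 0] by (simp add: liftable_def)
      then have "(h l * M l) $$ (a, b) = (0\<^sub>m (length (E (Suc 0))) 1 * M 0) $$ (a, b)"
        using 0 by simp
      also have "\<dots> = 0"
        using c[of 0] E0 ab Suc 0 by simp
      finally show ?thesis
        by simp
    next
      case (Suc m)
      then show ?thesis
        using ab cc[of _ m b] \<open>i = Suc l\<close>
        by (subst index_mult_mat_sum[OF ch c]) (auto simp: lookup_sum constant_coeff_mult)
    qed
    moreover have "(M i * h i) $$ (a, b) = d i $$ (a, b) - (h l * M l) $$ (a, b)"
      using h(2)[of l] ab Suc ch[of l] c[of l] by auto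
    ultimately have "constant_coeff (d i $$ (a, b)) = 0"
      by (simp add: lookup_minus)
    then show ?thesis
      using ab cT[of i] by (auto simp: d_def lookup_minus lookup_one split: if_splits)
  qed
qed

section \<open>Dimension count over the field\<close>

definition fun_scale :: "'k::field \<Rightarrow> ('b \<Rightarrow> 'k) \<Rightarrow> 'b \<Rightarrow> 'k" where
  "fun_scale c f = (\<lambda>x. c * f x)"

lemma fun_scale_apply [simp]: "fun_scale c f x = c * f x"
  by (simp add: fun_scale_def)

lemma sum_fun_apply [simp]: "(\<Sum>i\<in>A. f i) x = (\<Sum>i\<in>A. f i x)"
  for f :: "'a \<Rightarrow> 'b \<Rightarrow> 'c::comm_monoid_add"
  by (induction A rule: infinite_finite_induct) auto

lemma vector_space_fun: "vector_space (fun_scale :: 'k::field \<Rightarrow> ('b \<Rightarrow> 'k) \<Rightarrow> 'b \<Rightarrow> 'k)"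
  by standard (auto simp: fun_eq_iff algebra_simps)

text \<open>The identity matrix on \<open>B\<close> factors through coordinates indexed by
  \<open>A\<close>, so the columns of \<open>q\<close>, at most card A of them, span all unit
  vectors of \<open>B\<close>.\<close>

lemma card_le_of_left_inverse:
  fixes p :: "'a \<Rightarrow> 'b \<Rightarrow> 'k::field"
  assumes fin: "finite A" "finite B"
    and qp: "\<And>b b'. b \<in> B \<Longrightarrow> b' \<in> B \<Longrightarrow> (\<Sum>a\<in>A. q b a * p a b') = (if b = b' then 1 else 0)"
  shows "card B \<le> card A"
proof -
  interpret F: vector_space "fun_scale :: 'k \<Rightarrow> ('b \<Rightarrow> 'k) \<Rightarrow> 'b \<Rightarrow> 'k"
    by (rule vector_space_fun)
  define e :: "'b \<Rightarrow> 'b \<Rightarrow> 'k" where "e b = (\<lambda>x. if x = b then 1 else 0)" for b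
  define Q where "Q = (\<lambda>a b. if b \<in> B then q b a else 0) ` A"
  have inj: "inj_on e B"
    by (rule inj_onI) (metis e_def zero_neq_one)
  have "e ` B \<subseteq> F.span Q"
  proof
    fix f assume "f \<in> e ` B"
    then obtain b where b: "b \<in> B" "f = e b"
      by blast
    have "f = (\<Sum>a\<in>A. fun_scale (p a b) (\<lambda>b. if b \<in> B then q b a else 0))"
    proof
      fix x
      show "f x = (\<Sum>a\<in>A. fun_scale (p a b) (\<lambda>b. if b \<in> B then q b a else 0)) x"
        using qp[of x b] b by (cases "x \<in> B") (auto simp: e_def mult.commute)
    qed
    also have "\<dots> \<in> F.span Q"
      by (intro F.span_sum F.span_scale F.span_base) (auto simp: Q_def)
    finally show "f \<in> F.span Q" .
  qed
  moreover have "F.independent (e ` B)"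
  proof (rule F.independent_if_scalars_zero)
    fix u f assume 0: "(\<Sum>x\<in>e ` B. fun_scale (u x) x) = 0" and "f \<in> e ` B"
    then obtain b where b: "b \<in> B" "f = e b"
      by blast
    have "0 = (\<Sum>x\<in>e ` B. fun_scale (u x) x) b"
      by (simp only: 0 zero_fun_apply)
    also have "\<dots> = (\<Sum>b'\<in>B. u (e b') * e b' b)"
      by (simp add: sum.reindex[OF inj])
    also have "\<dots> = (\<Sum>b'\<in>B. if b' = b then u (e b') else 0)"
      by (rule sum.cong) (auto simp: e_def)
    also have "\<dots> = u f"
      using fin b by simp
    finally show "u f = 0"
      by simp
  qed (use fin in simp)
  ultimately have "card (e ` B) \<le> card Q"
    using F.independent_span_bound[of Q "e ` B"] fin by (simp add: Q_def)
  also have "card Q \<le> card A"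
    using fin by (simp add: Q_def card_image_le)
  finally show ?thesis
    by (simp add: card_image inj)
qed

text \<open>Modulo the irrelevant ideal the composite of the two comparison maps is the identity.
  Constant terms occur only between generators of equal degree, so the identity on the generators of
  degree j factors through those of degree j on the other side.\<close>

lemma resolution_count_le:
  fixes I :: "('v::finite, 'k::field) mpoly set"
  assumes r: "augmented_resolution I E M" and r': "augmented_resolution I E' M'"
  shows "count_list (E i) j \<le> count_list (E' i) j"
proof -
  obtain P where P: "P 0 = 1\<^sub>m 1" "\<And>i. graded_matrix (E i) (E' i) (P i)"
    "\<And>i. M' i * P (Suc i) = P i * M i"
    using resolution_comparison[OF r r'] by blast
  obtain Q where Q: "Q 0 = 1\<^sub>m 1" "\<And>i. graded_matrix (E' i) (E i) (Q i)"
    "\<And>i. M i * Q (Suc i) = Q i * M' i"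
    using resolution_comparison[OF r' r] by blast
  note cP = P(2)[THEN graded_matrix_carrier] and cQ = Q(2)[THEN graded_matrix_carrier]
  note c = augmented_resolution_carrier[OF r] and c' = augmented_resolution_carrier[OF r']
  have "M i * (Q (Suc i) * P (Suc i)) = Q i * P i * M i" for i
  proof -
    have "M i * (Q (Suc i) * P (Suc i)) = Q i * M' i * P (Suc i)"
      using assoc_mult_mat[OF c cQ cP, of i] by (simp add: Q(3))
    also have "\<dots> = Q i * (M' i * P (Suc i))"
      by (rule assoc_mult_mat[OF cQ c' cP])
    also have "\<dots> = Q i * P i * M i"
      unfolding P(3) by (rule assoc_mult_mat[OF cQ cP c, symmetric])
    finally show ?thesis .
  qed
  then have *: "constant_coeff ((Q i * P i) $$ (a, b)) = (if a = b then 1 else 0)"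
    if "a < length (E i)" "b < length (E i)" for a b
    using that P(1) Q(1) mult_carrier_mat[OF cQ cP]
    by (intro chain_endomorphism_constant_coeff[OF r, of "\<lambda>i. Q i * P i"]) auto
  let ?q = "\<lambda>b a. constant_coeff (Q i $$ (b, a))" and ?p = "\<lambda>a b. constant_coeff (P i $$ (a, b))"
  have degree: "E i ! b = E' i ! a" if "?q b a \<noteq> 0" "b < length (E i)" "a < length (E' i)" for a b
  proof -
    have "homogeneous (E' i ! a - E i ! b) (Q i $$ (b, a))"
      using Q(2) that by (simp add: graded_matrix_def)
    then show ?thesis
      using that(1) by (force simp: homogeneous_def in_keys_iff total_degree_def dest: bspec[of _ _ 0])
  qed
  let ?B = "{b. b < length (E i) \<and> E i ! b = j}" and ?A = "{a. a < length (E' i) \<and> E' i ! a = j}"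
  have "card ?B \<le> card ?A"
  proof (rule card_le_of_left_inverse)
    fix b b' assume b: "b \<in> ?B" "b' \<in> ?B"
    have "(\<Sum>a\<in>?A. ?q b a * ?p a b') = (\<Sum>a<length (E' i). ?q b a * ?p a b')"
      by (rule sum.mono_neutral_left) (use b degree in force)+
    also have "\<dots> = constant_coeff ((Q i * P i) $$ (b, b'))"
      using b by (subst index_mult_mat_sum[OF cQ cP]) (auto simp: lookup_sum constant_coeff_mult)
    finally show "(\<Sum>a\<in>?A. ?q b a * ?p a b') = (if b = b' then 1 else 0)"
      using b * by simp
  qed auto
  then show ?thesis
    by (simp add: count_list_eq_length_filter length_filter_conv_card eq_commute)
qed

lemma betti_eq:
  fixes I :: "('v::finite, 'k::field) mpoly set"
  assumes r: "minimal_graded_free_resolution I D g A"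
  shows "betti I (int i) j = count_list (D i) j"
proof -
  have "count_list (D' i) j = count_list (D i) j"
    if "minimal_graded_free_resolution I D' g' A'" for D' g' A'
    \<comment> \<open>\<open>Suc i\<close> accounts for the shift caused by the
      augmentation.\<close>
    using resolution_count_le[OF augmented_resolution_minimal[OF r] augmented_resolution_minimal[OF that], of "Suc i" j]
      resolution_count_le[OF augmented_resolution_minimal[OF that] augmented_resolution_minimal[OF r], of "Suc i" j]
    by simp
  then have "(THE n. \<exists>D g A. minimal_graded_free_resolution I D g A \<and> n = count_list (D i) j) =
    count_list (D i) j"
    using r by (intro the_equality) blast+
  then show ?thesis
    by (simp add: betti_def)
qed

section \<open>Squarefree resolutions as scalar data\<close>

text \<open>\<open>B i\<close> indexes the basis in step i, where step 0 is R. The differential sends the basis element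
  b of step i + 1 to the sum, over a in step i, of \<open>c i a b\<close> times the squarefree monomial with
  support \<open>\<sigma> (i + 1) b - \<sigma> i a\<close> times a. In every multidegree with support S this is the scalar
  complex on the basis elements whose degree is contained in S.\<close>

locale squarefree_resolution =
  fixes \<Gamma> :: "'v set set" and B :: "nat \<Rightarrow> nat set" and \<sigma> :: "nat \<Rightarrow> nat \<Rightarrow> 'v set"
    and c :: "nat \<Rightarrow> nat \<Rightarrow> nat \<Rightarrow> 'k::field"
  assumes finite_basis: "finite (B i)"
    and basis_0: "B 0 = {0}"
    and degree_0: "\<sigma> 0 0 = {}"
    and degree_less: "a \<in> B i \<Longrightarrow> b \<in> B (Suc i) \<Longrightarrow> c i a b \<noteq> 0 \<Longrightarrow> \<sigma> i a \<subset> \<sigma> (Suc i) b"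
    and column_nonzero: "b \<in> B (Suc i) \<Longrightarrow> \<exists>a\<in>B i. c i a b \<noteq> 0"
    and augmentation: "(\<exists>e\<in>\<Gamma>. e \<subseteq> S) \<longleftrightarrow> (\<exists>b\<in>B 1. \<sigma> 1 b \<subseteq> S \<and> c 0 0 b \<noteq> 0)"
    and complex: "a \<in> B i \<Longrightarrow> d \<in> B (Suc (Suc i)) \<Longrightarrow>
      (\<Sum>b\<in>B (Suc i). c i a b * c (Suc i) b d) = 0"
    and exact: "(\<And>b. b \<in> B (Suc i) \<Longrightarrow> y b \<noteq> 0 \<Longrightarrow> \<sigma> (Suc i) b \<subseteq> S) \<Longrightarrow>
      (\<And>a. a \<in> B i \<Longrightarrow> (\<Sum>b\<in>B (Suc i). c i a b * y b) = 0) \<Longrightarrow>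
      \<exists>z. (\<forall>d\<in>B (Suc (Suc i)). z d \<noteq> 0 \<longrightarrow> \<sigma> (Suc (Suc i)) d \<subseteq> S) \<and>
          (\<forall>b\<in>B (Suc i). y b = (\<Sum>d\<in>B (Suc (Suc i)). c (Suc i) b d * z d))"

section \<open>Linear algebra in spaces of functions\<close>

global_interpretation fun_space: vector_space "fun_scale :: 'k::field \<Rightarrow> ('b \<Rightarrow> 'k) \<Rightarrow> 'b \<Rightarrow> 'k"
  by (rule vector_space_fun)

lemma subspace_support:
  "fun_space.subspace {y :: 'b \<Rightarrow> 'k::field. \<forall>b. y b \<noteq> 0 \<longrightarrow> P b}"
  unfolding fun_space.subspace_def
proof (intro conjI ballI allI CollectI impI)
    fix x y b
    assume x: "x \<in> {y :: 'b \<Rightarrow> 'k. \<forall>b. y b \<noteq> 0 \<longrightarrow> P b}"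
      and y: "y \<in> {y :: 'b \<Rightarrow> 'k. \<forall>b. y b \<noteq> 0 \<longrightarrow> P b}" and "(x + y) b \<noteq> 0"
    then have "x b \<noteq> 0 \<or> y b \<noteq> 0"
      by auto
    then show "P b"
      using x y by blast
  next
    fix k x b
    assume x: "x \<in> {y :: 'b \<Rightarrow> 'k. \<forall>b. y b \<noteq> 0 \<longrightarrow> P b}" and "fun_scale k x b \<noteq> 0"
    then have "x b \<noteq> 0"
      by auto
    then show "P b"
      using x by blast
qed simp

lemma span_imageE:
  fixes f :: "'d \<Rightarrow> 'b \<Rightarrow> 'k::field"
  assumes "x \<in> fun_space.span (f ` D)" and "finite D"
  obtains z where "x = (\<Sum>d\<in>D. fun_scale (z d) (f d))"
proof -
  have "\<exists>z. x = (\<Sum>d\<in>D. fun_scale (z d) (f d))"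
    using assms(1)
  proof (induction rule: fun_space.span_induct_alt)
    case base
    have "0 = (\<Sum>d\<in>D. fun_scale 0 (f d))"
      by (auto simp: fun_eq_iff)
    then show ?case
      by (rule exI[of _ "\<lambda>_. 0"])
  next
    case (step k x y)
    then obtain d z where d: "d \<in> D" "x = f d" and y: "y = (\<Sum>d\<in>D. fun_scale (z d) (f d))"
      by blast
    have "fun_scale k x + y = (\<Sum>d'\<in>D. fun_scale (z d' + (if d' = d then k else 0)) (f d'))"
      using d y assms(2)
      by (auto simp: fun_eq_iff algebra_simps sum.distrib if_distrib[of "\<lambda>t. _ * t"] cong: if_cong)
    then show ?case
      by (rule exI[of _ "\<lambda>d'. z d' + (if d' = d then k else 0)"])
  qed
  then show thesis
    using that by blast
qed

text \<open>\<open>Bs\<close> represents a basis of K / L: a basis of \<open>L\<close> is extended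
  to one of \<open>K\<close>, and only the added vectors are kept. Finiteness comes from the common
  finite support.\<close>

lemma finite_relative_basis:
  fixes L K :: "('b \<Rightarrow> 'k::field) set"
  assumes L: "fun_space.subspace L" "L \<subseteq> K" and K: "finite B" "\<And>y b. y \<in> K \<Longrightarrow> y b \<noteq> 0 \<Longrightarrow> b \<in> B"
  shows "\<exists>Bs. finite Bs \<and> Bs \<subseteq> K \<and> K \<subseteq> fun_space.span (L \<union> Bs) \<and>
    (\<forall>u. (\<Sum>y\<in>Bs. fun_scale (u y) y) \<in> L \<longrightarrow> (\<forall>y\<in>Bs. u y = 0))"
proof -
  obtain S0 where S0: "S0 \<subseteq> L" "fun_space.independent S0" "L \<subseteq> fun_space.span S0"
    using fun_space.maximal_independent_subset[of L] by blast
  obtain S1 where S1: "S0 \<subseteq> S1" "S1 \<subseteq> K" "fun_space.independent S1" "K \<subseteq> fun_space.span S1"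
    using fun_space.maximal_independent_subset_extend[of S0 K] S0 L by blast
  define e :: "'b \<Rightarrow> 'b \<Rightarrow> 'k" where "e b = (\<lambda>x. if x = b then 1 else 0)" for b
  have "K \<subseteq> fun_space.span (e ` B)"
  proof
    fix y assume y: "y \<in> K"
    have "y = (\<Sum>b\<in>B. fun_scale (y b) (e b))"
    proof
      fix x
      have "(\<Sum>b\<in>B. fun_scale (y b) (e b)) x = (\<Sum>b\<in>B. if x = b then y b else 0)"
        by (auto simp: e_def intro!: sum.cong)
      then show "y x = (\<Sum>b\<in>B. fun_scale (y b) (e b)) x"
        using K y by (cases "x \<in> B") auto
    qed
    also have "\<dots> \<in> fun_space.span (e ` B)"
      by (intro fun_space.span_sum fun_space.span_scale fun_space.span_base) auto
    finally show "y \<in> fun_space.span (e ` B)" .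
  qed
  then have fin: "finite S1"
    using fun_space.independent_span_bound[of "e ` B" S1] S1 K(1) by auto
  show ?thesis
  proof (intro exI[of _ "S1 - S0"] conjI allI impI ballI)
    have "S1 \<subseteq> L \<union> (S1 - S0)"
      using S0 by blast
    then show "K \<subseteq> fun_space.span (L \<union> (S1 - S0))"
      using S1(4) fun_space.span_mono by blast
  next
    fix u y
    assume "(\<Sum>y\<in>S1 - S0. fun_scale (u y) y) \<in> L" and y: "y \<in> S1 - S0"
    then obtain w where w: "(\<Sum>y\<in>S1 - S0. fun_scale (u y) y) = (\<Sum>y\<in>S0. fun_scale (w y) y)"
      using S0(3) fun_space.span_finite[of S0] finite_subset[OF S1(1) fin] by auto
    \<comment> \<open>A combination of the added vectors that lies in \<open>L\<close> is also a
      combination of \<open>S0\<close>; moving the latter to the other side gives a relation on the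
      independent set \<open>S1\<close>.\<close>
    define t where "t y = (if y \<in> S0 then - w y else u y)" for y
    have "(\<Sum>y\<in>S1. fun_scale (t y) y) =
        (\<Sum>y\<in>S1 - S0. fun_scale (t y) y) + (\<Sum>y\<in>S0. fun_scale (t y) y)"
      using S1(1) fin by (rule sum.subset_diff)
    also have "(\<Sum>y\<in>S1 - S0. fun_scale (t y) y) = (\<Sum>y\<in>S1 - S0. fun_scale (u y) y)"
      by (rule sum.cong) (auto simp: t_def)
    also have "(\<Sum>y\<in>S0. fun_scale (t y) y) = - (\<Sum>y\<in>S0. fun_scale (w y) y)"
      by (simp add: t_def sum_negf[symmetric] cong: sum.cong)
    finally have "(\<Sum>y\<in>S1. fun_scale (t y) y) = 0"
      by (simp only: w add.right_inverse)
    then have "t y = 0"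
      using fun_space.independentD[OF S1(3) fin subset_refl, of t y] y by blast
    then show "u y = 0"
      using y by (simp add: t_def)
  qed (use fin S1 in auto)
qed

section \<open>Minimal covers of multigraded submodules\<close>

text \<open>\<open>B\<close> is a basis of a multigraded free module, \<open>\<sigma> b\<close> the squarefree degree of \<open>b\<close>, and \<open>K S\<close>
  the degree S part of a submodule contained in the irrelevant ideal times the module (whence the
  strict inclusion), in which degree S coordinates are identified with scalars.\<close>

definition strand_family :: "nat set \<Rightarrow> (nat \<Rightarrow> 'v set) \<Rightarrow> ('v set \<Rightarrow> (nat \<Rightarrow> 'k::field) set) \<Rightarrow> bool" where
  "strand_family B \<sigma> K \<longleftrightarrow> finite B \<and> (\<forall>S. fun_space.subspace (K S)) \<and>
     (\<forall>S. \<forall>y\<in>K S. \<forall>b. y b \<noteq> 0 \<longrightarrow> b \<in> B \<and> \<sigma> b \<subset> S) \<and> (\<forall>S T. S \<subseteq> T \<longrightarrow> K S \<subseteq> K T)"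

text \<open>The degree S strand of the kernel of the map with matrix \<open>c\<close>. Vanishing off
  \<open>B\<close> makes a syzygy determined by its coordinates.\<close>

definition syzygies ::
  "nat set \<Rightarrow> (nat \<Rightarrow> 'v set) \<Rightarrow> (nat \<Rightarrow> nat \<Rightarrow> 'k::field) \<Rightarrow> 'v set \<Rightarrow> (nat \<Rightarrow> 'k) set" where
  "syzygies B \<sigma> c S = {z. (\<forall>d. z d \<noteq> 0 \<longrightarrow> d \<in> B \<and> \<sigma> d \<subseteq> S) \<and> (\<forall>b. (\<Sum>d\<in>B. c b d * z d) = 0)}"

text \<open>The columns generate \<open>K\<close> in every degree. That they do so minimally is
  expressed separately, by the strict inclusion in \<open>strand_family\<close> for their
  syzygies.\<close>

definition covers ::
  "nat set \<Rightarrow> ('v set \<Rightarrow> (nat \<Rightarrow> 'k::field) set) \<Rightarrow> nat set \<Rightarrow> (nat \<Rightarrow> 'v set) \<Rightarrow> (nat \<Rightarrow> nat \<Rightarrow> 'k) \<Rightarrow> bool"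
where
  "covers B K B' \<sigma>' c \<longleftrightarrow>
     (\<forall>d\<in>B'. (\<lambda>b. c b d) \<in> K (\<sigma>' d) \<and> (\<exists>b\<in>B. c b d \<noteq> 0)) \<and>
     (\<forall>S. \<forall>y\<in>K S. \<exists>z. (\<forall>d\<in>B'. z d \<noteq> 0 \<longrightarrow> \<sigma>' d \<subseteq> S) \<and> (\<forall>b. y b = (\<Sum>d\<in>B'. c b d * z d)))"

text \<open>The argument behind Nakayama's lemma, degree by degree: \<open>L S\<close> is what
  smaller degrees generate, and a basis of K S / L S supplies the new generators of degree S. They
  generate by induction on S, and independence modulo \<open>L S\<close> keeps generators of degree
  S out of every syzygy of degree S.\<close>

lemma strand_family_cover:
  fixes K :: "'v::finite set \<Rightarrow> (nat \<Rightarrow> 'k::field) set"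
  assumes "strand_family B \<sigma> K"
  obtains B' \<sigma>' c where "covers B K B' \<sigma>' c" "strand_family B' \<sigma>' (syzygies B' \<sigma>' c)"
proof -
  have B: "finite B" and K: "fun_space.subspace (K S)"
    and supp: "y \<in> K S \<Longrightarrow> y b \<noteq> 0 \<Longrightarrow> b \<in> B \<and> \<sigma> b \<subset> S"
    and mono: "S \<subseteq> T \<Longrightarrow> K S \<subseteq> K T" for S T y b
    using assms by (simp_all add: strand_family_def)
  define L where "L S = fun_space.span (\<Union>T\<in>{T. T \<subset> S}. K T)" for S
  have L: "fun_space.subspace (L S)" for S
    by (simp add: L_def)
  have LK: "L S \<subseteq> K S" for S
    unfolding L_def
  proof (rule fun_space.span_minimal[OF _ K])
    show "(\<Union>T\<in>{T. T \<subset> S}. K T) \<subseteq> K S"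
      using mono[of _ S] by blast
  qed
  define Bs where "Bs S = (SOME Bs. finite Bs \<and> Bs \<subseteq> K S \<and> K S \<subseteq> fun_space.span (L S \<union> Bs) \<and>
    (\<forall>u. (\<Sum>y\<in>Bs. fun_scale (u y) y) \<in> L S \<longrightarrow> (\<forall>y\<in>Bs. u y = 0)))" for S
  have Bs_all: "finite (Bs S) \<and> Bs S \<subseteq> K S \<and> K S \<subseteq> fun_space.span (L S \<union> Bs S) \<and>
    (\<forall>u. (\<Sum>y\<in>Bs S. fun_scale (u y) y) \<in> L S \<longrightarrow> (\<forall>y\<in>Bs S. u y = 0))" for S
    unfolding Bs_def
    by (rule someI_ex, rule finite_relative_basis[OF L[of S] LK[of S] B supp[THEN conjunct1]])
  then have Bs: "finite (Bs S)" "Bs S \<subseteq> K S" "K S \<subseteq> fun_space.span (L S \<union> Bs S)" for S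
    by auto
  have indep: "u y = 0" if "(\<Sum>y\<in>Bs S. fun_scale (u y) y) \<in> L S" "y \<in> Bs S" for S u y
  proof -
    have "\<forall>u. (\<Sum>y\<in>Bs S. fun_scale (u y) y) \<in> L S \<longrightarrow> (\<forall>y\<in>Bs S. u y = 0)"
      using Bs_all[of S] by (elim conjE)
    from this[rule_format, OF that] show ?thesis .
  qed
  \<comment> \<open>Generators are pairs of a degree and a function, since one function may be new
    in several incomparable degrees, such as those of different edges.\<close>
  define Mset where "Mset = Sigma UNIV Bs"
  have "finite Mset"
    using Bs(1) by (simp add: Mset_def)
  then obtain h where h: "bij_betw h {0..<card Mset} Mset"
    using ex_bij_betw_nat_finite by blast
  define B' where "B' = {0..<card Mset}"
  define \<sigma>' where "\<sigma>' d = fst (h d)" for d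
  define col where "col d = snd (h d)" for d
  define c where "c b d = col d b" for b d
  have colB: "col d \<in> Bs (\<sigma>' d)" if "d \<in> B'" for d
    using bij_betwE[OF h] that by (force simp: B'_def Mset_def \<sigma>'_def col_def)
  then have colK: "col d \<in> K (\<sigma>' d)" if "d \<in> B'" for d
    using Bs(2) that by blast
  have bij: "bij_betw col {d \<in> B'. \<sigma>' d = S} (Bs S)" for S
  proof (rule bij_betw_imageI)
    show "inj_on col {d \<in> B'. \<sigma>' d = S}"
    proof (rule inj_onI)
      fix d d' assume "d \<in> {d \<in> B'. \<sigma>' d = S}" "d' \<in> {d \<in> B'. \<sigma>' d = S}" "col d = col d'"
      then show "d = d'"
        using inj_onD[OF bij_betw_imp_inj_on[OF h], of d d']
        by (auto simp: B'_def \<sigma>'_def col_def prod_eq_iff)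
    qed
    have "y \<in> col ` {d \<in> B'. \<sigma>' d = S}" if "y \<in> Bs S" for y
    proof -
      have "(S, y) \<in> h ` B'"
        using that h by (simp add: B'_def bij_betw_def Mset_def)
      then obtain d where "d \<in> B'" "h d = (S, y)"
        by (metis imageE)
      then show ?thesis
        by (intro image_eqI[of _ _ d]) (auto simp: \<sigma>'_def col_def)
    qed
    then show "col ` {d \<in> B'. \<sigma>' d = S} = Bs S"
      using colB by blast
  qed
  have gen: "K S \<subseteq> fun_space.span (col ` {d \<in> B'. \<sigma>' d \<subseteq> S})" for S
    using finite[of S]
  proof (induction S rule: finite_psubset_induct)
    case (psubset S)
    let ?G = "fun_space.span (col ` {d \<in> B'. \<sigma>' d \<subseteq> S})"
    have "K T \<subseteq> ?G" if "T \<subset> S" for T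
    proof -
      have "col ` {d \<in> B'. \<sigma>' d \<subseteq> T} \<subseteq> col ` {d \<in> B'. \<sigma>' d \<subseteq> S}"
        using that by blast
      then show ?thesis
        using psubset.IH[OF that] fun_space.span_mono by blast
    qed
    then have "L S \<subseteq> ?G"
      unfolding L_def by (intro fun_space.span_minimal) auto
    moreover have "Bs S \<subseteq> ?G"
    proof -
      have "Bs S = col ` {d \<in> B'. \<sigma>' d = S}"
        using bij[of S] by (simp add: bij_betw_def)
      also have "\<dots> \<subseteq> col ` {d \<in> B'. \<sigma>' d \<subseteq> S}"
        by blast
      finally show ?thesis
        using fun_space.span_superset by (rule order_trans)
    qed
    ultimately have "fun_space.span (L S \<union> Bs S) \<subseteq> ?G"
      by (intro fun_space.span_minimal) auto
    then show ?case
      using Bs(3) by blast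
  qed
  have finB': "finite B'"
    by (simp add: B'_def)
  have "covers B K B' \<sigma>' c"
    unfolding covers_def
  proof (intro conjI ballI allI)
    fix d assume d: "d \<in> B'"
    show "(\<lambda>b. c b d) \<in> K (\<sigma>' d)"
      using colK[OF d] by (simp add: c_def)
    have "col d \<noteq> 0"
    proof
      assume "col d = 0"
      then have "(\<Sum>y\<in>Bs (\<sigma>' d). fun_scale (if y = 0 then 1 else 0) y) = 0"
        by (intro sum.neutral) (auto simp: fun_eq_iff)
      then show False
        using indep[of "\<lambda>y. if y = 0 then 1 else 0" "\<sigma>' d" "col d"] colB[OF d] \<open>col d = 0\<close>
          fun_space.subspace_0[OF L] by auto
    qed
    then obtain b where "col d b \<noteq> 0"
      by (auto simp: fun_eq_iff)
    then show "\<exists>b\<in>B. c b d \<noteq> 0"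
      using supp[OF colK[OF d]] by (auto simp: c_def)
  next
    fix S y assume "y \<in> K S"
    then have "y \<in> fun_space.span (col ` {d \<in> B'. \<sigma>' d \<subseteq> S})"
      using gen[of S] by blast
    then obtain z where z: "y = (\<Sum>d\<in>{d \<in> B'. \<sigma>' d \<subseteq> S}. fun_scale (z d) (col d))"
      by (rule span_imageE) (simp add: finB')
    define z' where "z' d = (if \<sigma>' d \<subseteq> S then z d else 0)" for d
    have "y b = (\<Sum>d\<in>B'. c b d * z' d)" for b
      using finB' by (auto simp: z z'_def c_def mult.commute sum.inter_filter if_distrib
          intro!: sum.cong)
    then show "\<exists>z. (\<forall>d\<in>B'. z d \<noteq> 0 \<longrightarrow> \<sigma>' d \<subseteq> S) \<and> (\<forall>b. y b = (\<Sum>d\<in>B'. c b d * z d))"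
      by (intro exI[of _ z']) (simp add: z'_def)
  qed
  moreover have "strand_family B' \<sigma>' (syzygies B' \<sigma>' c)"
    unfolding strand_family_def
  proof (intro conjI allI ballI impI)
    fix S
    show "fun_space.subspace (syzygies B' \<sigma>' c S)"
    proof -
      have "fun_space.subspace {z. \<forall>b. (\<Sum>d\<in>B'. c b d * z d) = 0}"
        by (auto simp: fun_space.subspace_def distrib_left sum.distrib mult.left_commute
            sum_distrib_left[symmetric])
      then show ?thesis
        unfolding syzygies_def Collect_conj_eq
        by (intro fun_space.subspace_inter subspace_support)
    qed
  next
    fix S z d assume z: "z \<in> syzygies B' \<sigma>' c S" and d: "z d \<noteq> 0"
    then show "d \<in> B'"
      by (simp add: syzygies_def)
    have "\<sigma>' d \<subseteq> S"
      using z d by (simp add: syzygies_def)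
    moreover have "\<sigma>' d \<noteq> S"
    proof
      assume S: "\<sigma>' d = S"
      \<comment> \<open>The columns that occur in \<open>z\<close> outside degree S have degree
        strictly inside S, hence lie in \<open>L S\<close>. So the columns of degree S satisfy a
        relation modulo \<open>L S\<close>, which forces z d = 0.\<close>
      let ?D1 = "{d \<in> B'. \<sigma>' d = S}"
      have "(\<Sum>d\<in>B'. fun_scale (z d) (col d)) = 0"
        using z by (simp add: fun_eq_iff syzygies_def c_def mult.commute)
      then have "(\<Sum>d\<in>?D1. fun_scale (z d) (col d)) = - (\<Sum>d\<in>B' - ?D1. fun_scale (z d) (col d))"
        using sum.subset_diff[of ?D1 B' "\<lambda>d. fun_scale (z d) (col d)"] finB'
        by (simp add: eq_neg_iff_add_eq_0 add.commute)
      also have "\<dots> \<in> L S"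
      proof (intro fun_space.subspace_neg fun_space.subspace_sum L)
        fix d' assume d': "d' \<in> B' - ?D1"
        show "fun_scale (z d') (col d') \<in> L S"
        proof (cases "z d' = 0")
          case True
          then show ?thesis
            using fun_space.subspace_0[OF L] by simp
        next
          case False
          then have "\<sigma>' d' \<subset> S"
            using z d' by (auto simp: syzygies_def)
          then show ?thesis
            unfolding L_def using colK d'
            by (intro fun_space.span_scale fun_space.span_base) blast
        qed
      qed
      also have "(\<Sum>d\<in>?D1. fun_scale (z d) (col d)) =
          (\<Sum>y\<in>Bs S. fun_scale (z (the_inv_into ?D1 col y)) y)"
        by (subst sum.reindex_bij_betw[OF bij, symmetric])
          (use bij_betw_imp_inj_on[OF bij] in \<open>auto simp: the_inv_into_f_f intro!: sum.cong\<close>)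
      finally have "z (the_inv_into ?D1 col (col d)) = 0"
        using indep[of "\<lambda>y. z (the_inv_into ?D1 col y)"] colB[OF \<open>d \<in> B'\<close>] S by blast
      then show False
        using d S \<open>d \<in> B'\<close> bij_betw_imp_inj_on[OF bij] by (auto simp: the_inv_into_f_f)
    qed
    ultimately show "\<sigma>' d \<subset> S"
      by blast
  next
    fix S T :: "'v set" assume "S \<subseteq> T"
    then show "syzygies B' \<sigma>' c S \<subseteq> syzygies B' \<sigma>' c T"
      by (auto simp: syzygies_def)
  qed (rule finB')
  ultimately show thesis
    by (rule that)
qed

text \<open>The syzygies of a cover form a strand family again, so covers can be iterated. The
  assumption on \<open>\<Gamma>\<close> places the ideal inside the irrelevant ideal, which starts
  the iteration.\<close>

lemma ex_squarefree_resolution: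
  fixes \<Gamma> :: "'v::finite set set"
  assumes "{} \<notin> \<Gamma>"
  obtains B \<sigma> and c :: "nat \<Rightarrow> nat \<Rightarrow> nat \<Rightarrow> 'k::field" where "squarefree_resolution \<Gamma> B \<sigma> c"
proof -
  define K0 :: "'v set \<Rightarrow> (nat \<Rightarrow> 'k) set"
    where "K0 S = {y. \<forall>b. y b \<noteq> 0 \<longrightarrow> b = 0 \<and> (\<exists>e\<in>\<Gamma>. e \<subseteq> S)}" for S
  define P :: "nat \<Rightarrow> nat set \<times> (nat \<Rightarrow> 'v set) \<times> (nat \<Rightarrow> nat \<Rightarrow> 'k) \<times> ('v set \<Rightarrow> (nat \<Rightarrow> 'k) set) \<Rightarrow> bool"
    where "P n s = (case s of (B, \<sigma>, c, K) \<Rightarrow> strand_family B \<sigma> K \<and>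
        (n = 0 \<longrightarrow> B = {0} \<and> \<sigma> = (\<lambda>_. {}) \<and> K = K0))" for n s
  define Q :: "nat set \<times> (nat \<Rightarrow> 'v set) \<times> (nat \<Rightarrow> nat \<Rightarrow> 'k) \<times> ('v set \<Rightarrow> (nat \<Rightarrow> 'k) set) \<Rightarrow> nat set \<times> (nat \<Rightarrow> 'v set) \<times> (nat \<Rightarrow> nat \<Rightarrow> 'k) \<times> ('v set \<Rightarrow> (nat \<Rightarrow> 'k) set) \<Rightarrow> bool"
    where "Q s s' = (case s of (B, \<sigma>, c, K) \<Rightarrow> case s' of (B', \<sigma>', c', K') \<Rightarrow>
        covers B K B' \<sigma>' c' \<and> K' = syzygies B' \<sigma>' c')" for s s'
  have "\<exists>f. \<forall>n. P n (f n) \<and> Q (f n) (f (Suc n))"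
  proof (rule dependent_nat_choice)
    have "strand_family {0} (\<lambda>_. {}) K0"
      unfolding strand_family_def
    proof (intro conjI allI ballI impI)
      fix S
      show "fun_space.subspace (K0 S)"
        unfolding K0_def by (rule subspace_support)
    next
      fix S y b assume y: "y \<in> K0 S" "y b \<noteq> 0"
      then show "b \<in> {0}"
        by (simp add: K0_def)
      obtain e where "e \<in> \<Gamma>" "e \<subseteq> S"
        using y by (auto simp: K0_def)
      moreover have "e \<noteq> {}"
        using \<open>e \<in> \<Gamma>\<close> assms by blast
      ultimately show "{} \<subset> S"
        by blast
    next
      fix S T :: "'v set" assume "S \<subseteq> T"
      then have "(\<exists>e\<in>\<Gamma>. e \<subseteq> S) \<Longrightarrow> (\<exists>e\<in>\<Gamma>. e \<subseteq> T)"
        by (meson order_trans)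
      then show "K0 S \<subseteq> K0 T"
        by (auto simp: K0_def)
    qed simp
    then show "\<exists>s. P 0 s"
      by (auto simp: P_def)
  next
    fix s n assume "P n s"
    then obtain B \<sigma> c K where s: "s = (B, \<sigma>, c, K)" "strand_family B \<sigma> K"
      by (auto simp: P_def split: prod.splits)
    obtain B' \<sigma>' c' where "covers B K B' \<sigma>' c'" "strand_family B' \<sigma>' (syzygies B' \<sigma>' c')"
      using strand_family_cover[OF s(2)] .
    then show "\<exists>s'. P (Suc n) s' \<and> Q s s'"
      by (intro exI[of _ "(B', \<sigma>', c', syzygies B' \<sigma>' c')"]) (simp add: P_def Q_def s)
  qed
  then obtain f where f: "\<And>n. P n (f n)" "\<And>n. Q (f n) (f (Suc n))"
    by blast
  define B \<sigma> K where "B i = fst (f i)" and "\<sigma> i = fst (snd (f i))"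
    and "K i = snd (snd (snd (f i)))" for i
  \<comment> \<open>A state stores the differential that leaves its own step, so the one from step i
    + 1 to step i sits in state i + 1.\<close>
  define c where "c i = fst (snd (snd (f (Suc i))))" for i
  have fam: "strand_family (B i) (\<sigma> i) (K i)" for i
    using f(1)[of i] by (auto simp: P_def B_def \<sigma>_def K_def split: prod.splits)
  have 0: "B 0 = {0}" "\<sigma> 0 = (\<lambda>_. {})" "K 0 = K0"
    using f(1)[of 0] by (auto simp: P_def B_def \<sigma>_def K_def split: prod.splits)
  have Q: "covers (B i) (K i) (B (Suc i)) (\<sigma> (Suc i)) (c i) \<and>
    K (Suc i) = syzygies (B (Suc i)) (\<sigma> (Suc i)) (c i)" for i
    using f(2)[of i] by (simp add: Q_def B_def \<sigma>_def K_def c_def case_prod_beta)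
  have cov: "covers (B i) (K i) (B (Suc i)) (\<sigma> (Suc i)) (c i)"
    and syz: "K (Suc i) = syzygies (B (Suc i)) (\<sigma> (Suc i)) (c i)" for i
    using Q by blast+
  have cover: "\<exists>z. (\<forall>d\<in>B (Suc i). z d \<noteq> 0 \<longrightarrow> \<sigma> (Suc i) d \<subseteq> S) \<and>
      (\<forall>b. y b = (\<Sum>d\<in>B (Suc i). c i b d * z d))" if "y \<in> K i S" for i S y
    using cov[of i] that by (simp add: covers_def)
  have col: "(\<lambda>a. c i a b) \<in> K i (\<sigma> (Suc i) b)" if "b \<in> B (Suc i)" for i b
    using cov[of i] that by (simp add: covers_def)
  have suppK: "b \<in> B i \<and> \<sigma> i b \<subset> S" if "y \<in> K i S" "y b \<noteq> 0" for i S y b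
    using fam[of i] that by (simp add: strand_family_def)
  have fin: "finite (B i)" for i
    using fam[of i] by (simp add: strand_family_def)
  have "squarefree_resolution \<Gamma> B \<sigma> c"
  proof
    fix i a b assume "a \<in> B i" "b \<in> B (Suc i)" "c i a b \<noteq> 0"
    then show "\<sigma> i a \<subset> \<sigma> (Suc i) b"
      using suppK[OF col[of b i]] by simp
  next
    fix i b assume "b \<in> B (Suc i)"
    then show "\<exists>a\<in>B i. c i a b \<noteq> 0"
      using cov[of i] by (simp add: covers_def)
  next
    fix S
    show "(\<exists>e\<in>\<Gamma>. e \<subseteq> S) \<longleftrightarrow> (\<exists>b\<in>B 1. \<sigma> 1 b \<subseteq> S \<and> c 0 0 b \<noteq> 0)"
    proof
      assume "\<exists>e\<in>\<Gamma>. e \<subseteq> S"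
      then have "(\<lambda>a. if a = 0 then 1 else 0) \<in> K 0 S"
        by (simp add: 0 K0_def)
      from cover[OF this] obtain z where z: "\<forall>d\<in>B 1. z d \<noteq> 0 \<longrightarrow> \<sigma> 1 d \<subseteq> S"
        "\<forall>b. (if b = 0 then 1 else 0) = (\<Sum>d\<in>B 1. c 0 b d * z d)"
        unfolding One_nat_def[symmetric] by blast
      have "(\<Sum>d\<in>B 1. c 0 0 d * z d) \<noteq> 0"
        using z(2)[rule_format, of 0] by simp
      then obtain d where "d \<in> B 1" "c 0 0 d * z d \<noteq> 0"
        by (rule sum.not_neutral_contains_not_neutral)
      then show "\<exists>b\<in>B 1. \<sigma> 1 b \<subseteq> S \<and> c 0 0 b \<noteq> 0"
        using z(1) by auto
    next
      assume "\<exists>b\<in>B 1. \<sigma> 1 b \<subseteq> S \<and> c 0 0 b \<noteq> 0"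
      then obtain b where "b \<in> B 1" "\<sigma> 1 b \<subseteq> S" "c 0 0 b \<noteq> 0"
        by blast
      moreover have "(\<lambda>a. c 0 a b) \<in> K0 (\<sigma> 1 b)"
        using col[of b 0] \<open>b \<in> B 1\<close> by (simp add: 0)
      ultimately show "\<exists>e\<in>\<Gamma>. e \<subseteq> S"
        unfolding K0_def by blast
    qed
  next
    fix i a d assume "d \<in> B (Suc (Suc i))"
    then show "(\<Sum>b\<in>B (Suc i). c i a b * c (Suc i) b d) = 0"
      using col[of d "Suc i"] by (simp add: syz syzygies_def)
  next
    fix i S y
    assume y: "\<And>b. b \<in> B (Suc i) \<Longrightarrow> y b \<noteq> 0 \<Longrightarrow> \<sigma> (Suc i) b \<subseteq> S"
      and cy: "\<And>a. a \<in> B i \<Longrightarrow> (\<Sum>b\<in>B (Suc i). c i a b * y b) = 0"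
    \<comment> \<open>\<open>y\<close> is arbitrary off the basis, whereas syzygies vanish
      there.\<close>
    define y' where "y' b = (if b \<in> B (Suc i) then y b else 0)" for b
    have "(\<Sum>b\<in>B (Suc i). c i a b * y' b) = 0" for a
    proof (cases "a \<in> B i")
      case True
      then show ?thesis
        using cy by (simp add: y'_def)
    next
      case False
      then have "c i a b = 0" if "b \<in> B (Suc i)" for b
        using suppK[OF col[OF that]] by blast
      then show ?thesis
        by simp
    qed
    then have "y' \<in> K (Suc i) S"
      using y by (auto simp: syz syzygies_def y'_def)
    then obtain z where z: "\<forall>d\<in>B (Suc (Suc i)). z d \<noteq> 0 \<longrightarrow> \<sigma> (Suc (Suc i)) d \<subseteq> S"
      "\<forall>b. y' b = (\<Sum>d\<in>B (Suc (Suc i)). c (Suc i) b d * z d)"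
      using cover by blast
    moreover have "\<forall>b\<in>B (Suc i). y b = y' b"
      by (simp add: y'_def)
    ultimately show "\<exists>z. (\<forall>d\<in>B (Suc (Suc i)). z d \<noteq> 0 \<longrightarrow> \<sigma> (Suc (Suc i)) d \<subseteq> S) \<and>
      (\<forall>b\<in>B (Suc i). y b = (\<Sum>d\<in>B (Suc (Suc i)). c (Suc i) b d * z d))"
      by auto
  qed (use fin 0 in auto)
  then show thesis
    by (rule that)
qed

section \<open>Growth of degrees and restriction to a set of variables\<close>

context squarefree_resolution
begin

text \<open>Nonzero columns give a chain of i strict inclusions ending in the degree of
  \<open>b\<close>. As degrees are sets of variables, this bounds the length of the
  resolution.\<close>

lemma card_degree_ge:
  assumes "finite (UNIV :: 'v set)"
  shows "b \<in> B i \<Longrightarrow> i \<le> card (\<sigma> i b)"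
proof (induction i arbitrary: b)
  case (Suc i)
  obtain a where a: "a \<in> B i" "c i a b \<noteq> 0"
    using column_nonzero[OF Suc.prems] by blast
  then have "\<sigma> i a \<subset> \<sigma> (Suc i) b"
    using Suc.prems by (intro degree_less)
  moreover have "finite (\<sigma> (Suc i) b)"
    using assms by (rule rev_finite_subset) simp
  ultimately have "card (\<sigma> i a) < card (\<sigma> (Suc i) b)"
    by (intro psubset_card_mono)
  then show ?case
    using Suc.IH[OF a(1)] by simp
qed simp

text \<open>The differential leads to smaller degrees, so the basis elements of degree inside
  \<open>W\<close> span a subcomplex. Its strand for S is the full strand for the intersection of S
  and \<open>W\<close>, hence exact.\<close>

lemma restrict:
  "squarefree_resolution {e \<in> \<Gamma>. e \<subseteq> W} (\<lambda>i. {b \<in> B i. \<sigma> i b \<subseteq> W}) \<sigma> c"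
proof -
  let ?B = "\<lambda>i. {b \<in> B i. \<sigma> i b \<subseteq> W}"
  have inW: "\<sigma> i a \<subseteq> W" if "a \<in> B i" "b \<in> ?B (Suc i)" "c i a b \<noteq> 0" for i a b
    using degree_less[of a i b] that by blast
  show ?thesis
  proof
    show "finite (?B i)" for i
      using finite_basis by simp
    show "?B 0 = {0}" "\<sigma> 0 0 = {}"
      by (auto simp: basis_0 degree_0)
    show "\<sigma> i a \<subset> \<sigma> (Suc i) b" if "a \<in> ?B i" "b \<in> ?B (Suc i)" "c i a b \<noteq> 0" for i a b
      using degree_less that by simp
    show "\<exists>a\<in>?B i. c i a b \<noteq> 0" if "b \<in> ?B (Suc i)" for i b
      using column_nonzero[of b i] inW that by blast
    show "(\<exists>e\<in>{e \<in> \<Gamma>. e \<subseteq> W}. e \<subseteq> S) \<longleftrightarrow> (\<exists>b\<in>?B 1. \<sigma> 1 b \<subseteq> S \<and> c 0 0 b \<noteq> 0)" for S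
      using augmentation[of "S \<inter> W"] by auto
  next
    fix i a d assume ad: "a \<in> ?B i" "d \<in> ?B (Suc (Suc i))"
    have "(\<Sum>b\<in>?B (Suc i). c i a b * c (Suc i) b d) = (\<Sum>b\<in>B (Suc i). c i a b * c (Suc i) b d)"
      by (rule sum.mono_neutral_left) (use finite_basis inW[of _ "Suc i" d] ad in auto)
    then show "(\<Sum>b\<in>?B (Suc i). c i a b * c (Suc i) b d) = 0"
      using complex ad by simp
  next
    fix i S y
    assume y: "\<And>b. b \<in> ?B (Suc i) \<Longrightarrow> y b \<noteq> 0 \<Longrightarrow> \<sigma> (Suc i) b \<subseteq> S"
      and cy: "\<And>a. a \<in> ?B i \<Longrightarrow> (\<Sum>b\<in>?B (Suc i). c i a b * y b) = 0"
    \<comment> \<open>Extended by 0, the cycle stays a cycle: a row of degree not inside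
      \<open>W\<close> has zero entries in all columns of degree inside \<open>W\<close>.\<close>
    define y' where "y' b = (if \<sigma> (Suc i) b \<subseteq> W then y b else 0)" for b
    have "(\<Sum>b\<in>B (Suc i). c i a b * y' b) = 0" if a: "a \<in> B i" for a
    proof -
      have "(\<Sum>b\<in>B (Suc i). c i a b * y' b) = (\<Sum>b\<in>?B (Suc i). c i a b * y b)"
        by (rule sum.mono_neutral_cong_right) (auto simp: y'_def finite_basis)
      also have "\<dots> = 0"
      proof (cases "\<sigma> i a \<subseteq> W")
        case True
        then show ?thesis
          using cy a by simp
      next
        case False
        then show ?thesis
          using inW[OF a] by (intro sum.neutral) auto
      qed
      finally show ?thesis .
    qed
    then have "\<exists>z. (\<forall>d\<in>B (Suc (Suc i)). z d \<noteq> 0 \<longrightarrow> \<sigma> (Suc (Suc i)) d \<subseteq> S \<inter> W) \<and>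
        (\<forall>b\<in>B (Suc i). y' b = (\<Sum>d\<in>B (Suc (Suc i)). c (Suc i) b d * z d))"
      by (rule exact[rotated]) (use y in \<open>auto simp: y'_def split: if_splits\<close>)
    then obtain z where z: "\<forall>d\<in>B (Suc (Suc i)). z d \<noteq> 0 \<longrightarrow> \<sigma> (Suc (Suc i)) d \<subseteq> S \<inter> W"
      "\<forall>b\<in>B (Suc i). y' b = (\<Sum>d\<in>B (Suc (Suc i)). c (Suc i) b d * z d)"
      by blast
    have "y b = (\<Sum>d\<in>?B (Suc (Suc i)). c (Suc i) b d * z d)" if "b \<in> ?B (Suc i)" for b
    proof -
      have "y b = (\<Sum>d\<in>B (Suc (Suc i)). c (Suc i) b d * z d)"
        using z(2) that by (auto simp: y'_def)
      also have "\<dots> = (\<Sum>d\<in>?B (Suc (Suc i)). c (Suc i) b d * z d)"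
        by (rule sum.mono_neutral_right) (use z(1) in \<open>auto simp: finite_basis\<close>)
      finally show ?thesis .
    qed
    with z(1) show "\<exists>z. (\<forall>d\<in>?B (Suc (Suc i)). z d \<noteq> 0 \<longrightarrow> \<sigma> (Suc (Suc i)) d \<subseteq> S) \<and>
      (\<forall>b\<in>?B (Suc i). y b = (\<Sum>d\<in>?B (Suc (Suc i)). c (Suc i) b d * z d))"
      by (intro exI[of _ z]) auto
  qed
qed

end

section \<open>The Koszul complex of a star\<close>

text \<open>The usual sign of the facet T - {t} in the boundary of T, with T ordered by
  \<open>f\<close>.\<close>

definition koszul_sign :: "('v \<Rightarrow> nat) \<Rightarrow> 'v \<Rightarrow> 'v set \<Rightarrow> 'k::comm_ring_1" where
  "koszul_sign f t T = (- 1) ^ card {x \<in> T. f x < f t}"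

text \<open>The boundary of a boundary vanishes: removing t and then u leaves the same set as the
  reverse order, with the opposite sign.\<close>

lemma koszul_sign_square:
  assumes "finite T" "inj f"
  shows "(\<Sum>t\<in>T. koszul_sign f t T * (\<Sum>u\<in>T - {t}. koszul_sign f u (T - {t}) * g (T - {t} - {u}))) =
    (0 :: 'k::comm_ring_1)"
proof -
  \<comment> \<open>Both signs are measured in all of \<open>T\<close>, which makes \<open>k\<close>
    symmetric. Removing t first flips the sign of u exactly when t precedes u.\<close>
  define k :: "'a \<Rightarrow> 'a \<Rightarrow> 'k"
    where "k t u = koszul_sign f t T * koszul_sign f u T * g (T - {t} - {u})" for t u
  have sign: "koszul_sign f t T * (koszul_sign f u (T - {t}) * g (T - {t} - {u})) =
      (if f u < f t then k t u else - k t u)" if "t \<in> T" "u \<in> T - {t}" for t u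
  proof (cases "f u < f t")
    case True
    then have "{x \<in> T - {t}. f x < f u} = {x \<in> T. f x < f u}"
      by auto
    then show ?thesis
      using True by (simp add: k_def koszul_sign_def)
  next
    case False
    then have "f t < f u"
      using that inj_eq[OF assms(2), of t u] by (cases "f t" "f u" rule: linorder_cases) auto
    then have "{x \<in> T. f x < f u} = insert t {x \<in> T - {t}. f x < f u}"
      using that by auto
    then have "card {x \<in> T. f x < f u} = Suc (card {x \<in> T - {t}. f x < f u})"
      using assms(1) by simp
    then show ?thesis
      using False by (simp add: k_def koszul_sign_def)
  qed
  have k_sym: "k t u = k u t" for t u
  proof -
    have "T - {t} - {u} = T - {u} - {t}"
      by blast
    then show ?thesis
      by (simp add: k_def mult.commute)
  qed
  have "(\<Sum>t\<in>T. koszul_sign f t T * (\<Sum>u\<in>T - {t}. koszul_sign f u (T - {t}) * g (T - {t} - {u}))) =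
      (\<Sum>t\<in>T. \<Sum>u\<in>T - {t}. if f u < f t then k t u else - k t u)"
    unfolding sum_distrib_left by (intro sum.cong refl sign)
  also have "\<dots> = (\<Sum>t\<in>T. (\<Sum>u\<in>{u \<in> T. f u < f t}. k t u) - (\<Sum>u\<in>{u \<in> T. f t < f u}. k t u))"
  proof (rule sum.cong)
    fix t assume t: "t \<in> T"
    have "f u < f t \<or> f t < f u \<longleftrightarrow> u \<noteq> t" for u
      using inj_eq[OF assms(2), of u t] by linarith
    then have split: "T - {t} = {u \<in> T. f u < f t} \<union> {u \<in> T. f t < f u}"
      by blast
    have "(\<Sum>u\<in>T - {t}. if f u < f t then k t u else - k t u) =
      (\<Sum>u\<in>{u \<in> T. f u < f t}. if f u < f t then k t u else - k t u) +
      (\<Sum>u\<in>{u \<in> T. f t < f u}. if f u < f t then k t u else - k t u)"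
      unfolding split by (rule sum.union_disjoint) (auto simp: assms(1))
    also have "(\<Sum>u\<in>{u \<in> T. f u < f t}. if f u < f t then k t u else - k t u) =
        (\<Sum>u\<in>{u \<in> T. f u < f t}. k t u)"
      by (rule sum.cong) auto
    also have "(\<Sum>u\<in>{u \<in> T. f t < f u}. if f u < f t then k t u else - k t u) =
        - (\<Sum>u\<in>{u \<in> T. f t < f u}. k t u)"
      unfolding sum_negf[symmetric] by (rule sum.cong) auto
    finally show "(\<Sum>u\<in>T - {t}. if f u < f t then k t u else - k t u) =
      (\<Sum>u\<in>{u \<in> T. f u < f t}. k t u) - (\<Sum>u\<in>{u \<in> T. f t < f u}. k t u)"
      by simp
  qed simp
  also have "\<dots> = 0"
    using sum.swap_restrict[OF assms(1) assms(1), of k "\<lambda>t u. f u < f t"]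
    by (simp add: sum_subtractf k_sym)
  finally show ?thesis .
qed

context squarefree_resolution
begin

text \<open>The star with center \<open>v\<close> and leaves \<open>U\<close> gives a chain map from the Koszul complex on \<open>U\<close>
  (multiplied by \<open>v\<close>) to the resolution, whose value on the basis element \<open>T\<close> is \<open>p T\<close>.\<close>

definition koszul_chain :: "('v \<Rightarrow> nat) \<Rightarrow> 'v \<Rightarrow> 'v set \<Rightarrow> ('v set \<Rightarrow> nat \<Rightarrow> 'k) \<Rightarrow> bool" where
  "koszul_chain f v T p \<longleftrightarrow> (\<forall>b\<in>B (card T). p T b \<noteq> 0 \<longrightarrow> \<sigma> (card T) b \<subseteq> insert v T) \<and>
     (if T = {} then p T 0 = 1
      else \<forall>a\<in>B (card T - 1). (\<Sum>b\<in>B (card T). c (card T - 1) a b * p T b) =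
        (\<Sum>t\<in>T. koszul_sign f t T * p (T - {t}) a))"

text \<open>The value on \<open>T\<close> must be a preimage of the boundary term \<open>y\<close>.
  This is a cycle, because \<open>p\<close> is a chain map on smaller sets and the Koszul boundary
  squares to 0, so exactness gives a preimage; for a single leaf t the edge {v, t} gives one
  instead.\<close>

lemma koszul_chain_step:
  assumes T: "finite T" "T \<noteq> {}" and f: "inj f" and star: "\<And>t. t \<in> T \<Longrightarrow> {v, t} \<in> \<Gamma>"
    and p: "\<And>T'. T' \<subset> T \<Longrightarrow> koszul_chain f v T' p"
  shows "\<exists>q. koszul_chain f v T (p(T := q))"
proof -
  define y where "y a = (\<Sum>t\<in>T. koszul_sign f t T * p (T - {t}) a)" for a
  obtain n where n: "card T = Suc n"
    using T by (metis card_eq_0_iff not0_implies_Suc)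
  have card': "card (T - {t}) = n" if "t \<in> T" for t
    using n T(1) that by simp
  have supp: "\<sigma> n a \<subseteq> insert v T" if "a \<in> B n" "y a \<noteq> 0" for a
  proof -
    from that(2) obtain t where t: "t \<in> T" "koszul_sign f t T * p (T - {t}) a \<noteq> 0"
      unfolding y_def by (rule sum.not_neutral_contains_not_neutral)
    then have "p (T - {t}) a \<noteq> 0"
      by auto
    moreover have "koszul_chain f v (T - {t}) p"
      using t(1) by (intro p) auto
    ultimately show ?thesis
      using that(1) t(1) by (auto simp: koszul_chain_def n)
  qed
  have "\<exists>q. (\<forall>b\<in>B (Suc n). q b \<noteq> 0 \<longrightarrow> \<sigma> (Suc n) b \<subseteq> insert v T) \<and>
    (\<forall>a\<in>B n. y a = (\<Sum>b\<in>B (Suc n). c n a b * q b))"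
  proof (cases n)
    case 0
    then obtain t where t: "T = {t}"
      using n card_1_singletonE by auto
    then have "\<exists>e\<in>\<Gamma>. e \<subseteq> insert v T"
      using star[of t] by auto
    then obtain b where b: "b \<in> B 1" "\<sigma> 1 b \<subseteq> insert v T" "c 0 0 b \<noteq> 0"
      using augmentation by blast
    have "y 0 = (\<Sum>d\<in>B 1. c 0 0 d * (if d = b then y 0 / c 0 0 b else 0))"
      using b finite_basis by (simp add: if_distrib[of "\<lambda>x. _ * x"] cong: if_cong)
    then show ?thesis
      using b by (intro exI[of _ "\<lambda>d. if d = b then y 0 / c 0 0 b else 0"]) (auto simp: 0 basis_0)
  next
    case (Suc i)
    have "(\<Sum>b\<in>B n. c i a b * y b) = 0" if a: "a \<in> B i" for a
    proof -
      have "(\<Sum>b\<in>B n. c i a b * y b) =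
          (\<Sum>t\<in>T. koszul_sign f t T * (\<Sum>b\<in>B n. c i a b * p (T - {t}) b))"
        unfolding y_def sum_distrib_left by (subst sum.swap) (simp add: mult.left_commute)
      also have "\<dots> = (\<Sum>t\<in>T. koszul_sign f t T *
          (\<Sum>u\<in>T - {t}. koszul_sign f u (T - {t}) * p (T - {t} - {u}) a))"
      proof (intro sum.cong refl arg_cong2[of _ _ _ _ "(*)"])
        fix t assume t: "t \<in> T"
        moreover have "koszul_chain f v (T - {t}) p"
          using t by (intro p) auto
        moreover have "T - {t} \<noteq> {}"
          using card'[OF t] Suc by (metis card.empty nat.distinct(1))
        ultimately show "(\<Sum>b\<in>B n. c i a b * p (T - {t}) b) =
            (\<Sum>u\<in>T - {t}. koszul_sign f u (T - {t}) * p (T - {t} - {u}) a)"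
          using a Suc n by (simp add: koszul_chain_def)
      qed
      also have "\<dots> = 0"
        by (rule koszul_sign_square[OF T(1) f])
      finally show ?thesis .
    qed
    then show ?thesis
      unfolding Suc using supp by (intro exact) (auto simp: Suc)
  qed
  then obtain q where q: "\<forall>b\<in>B (Suc n). q b \<noteq> 0 \<longrightarrow> \<sigma> (Suc n) b \<subseteq> insert v T"
    "\<forall>a\<in>B n. y a = (\<Sum>b\<in>B (Suc n). c n a b * q b)"
    by blast
  define p' where "p' = p(T := q)"
  have p': "p' T = q" "p' (T - {t}) = p (T - {t})" if "t \<in> T" for t
    using that by (auto simp: p'_def)
  have "(\<Sum>t\<in>T. koszul_sign f t T * p' (T - {t}) a) = y a" for a
    unfolding y_def by (intro sum.cong refl) (simp only: p')
  moreover have "p' T = q"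
    by (simp add: p'_def)
  ultimately have "koszul_chain f v T (p(T := q))"
    using q T(2) unfolding koszul_chain_def n p'_def[symmetric] by simp
  then show ?thesis
    by blast
qed

text \<open>As the condition at \<open>T\<close> reads \<open>p\<close> only at \<open>T\<close> and
  its facets, values can be chosen one cardinality at a time.\<close>

lemma koszul_chain_cong:
  assumes "p T = p' T" "\<And>t. t \<in> T \<Longrightarrow> p (T - {t}) = p' (T - {t})"
  shows "koszul_chain f v T p \<longleftrightarrow> koszul_chain f v T p'"
  using assms by (cases "T = {}") (simp_all add: koszul_chain_def cong: sum.cong)

lemma ex_koszul_chain:
  assumes U: "finite U" and f: "inj f" and star: "\<And>t. t \<in> U \<Longrightarrow> {v, t} \<in> \<Gamma>"
  obtains p where "\<And>T. T \<subseteq> U \<Longrightarrow> koszul_chain f v T p"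
proof -
  have "\<exists>p. \<forall>T\<subseteq>U. card T \<le> n \<longrightarrow> koszul_chain f v T p" for n
  proof (induction n)
    case 0
    have "koszul_chain f v {} (\<lambda>_ _. 1)"
      by (auto simp: koszul_chain_def basis_0 degree_0)
    then show ?case
      using U by (intro exI[of _ "\<lambda>_ _. 1"]) (auto dest: finite_subset)
  next
    case (Suc n)
    then obtain p where p: "\<And>T. T \<subseteq> U \<Longrightarrow> card T \<le> n \<Longrightarrow> koszul_chain f v T p"
      by blast
    have "\<exists>q. koszul_chain f v T (p(T := q))" if T: "T \<subseteq> U" "card T = Suc n" for T
    proof (rule koszul_chain_step[OF _ _ f])
      show "finite T"
        using T(1) U by (rule finite_subset)
      then show "koszul_chain f v T' p" if "T' \<subset> T" for T'
        using psubset_card_mono[OF _ that] T that by (intro p) auto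
    qed (use T star in auto)
    then obtain q where q: "\<And>T. T \<subseteq> U \<Longrightarrow> card T = Suc n \<Longrightarrow> koszul_chain f v T (p(T := q T))"
      by metis
    define p' where "p' T = (if card T = Suc n then q T else p T)" for T
    have "koszul_chain f v T p'" if T: "T \<subseteq> U" "card T \<le> Suc n" for T
    proof -
      have fin: "finite T"
        using T(1) U by (rule finite_subset)
      have sub: "p' (T - {t}) = p (T - {t})" if "t \<in> T" for t
      proof -
        have "card (T - {t}) < card T"
          using fin that by (rule card_Diff1_less)
        then show ?thesis
          using T(2) by (simp add: p'_def)
      qed
      show ?thesis
      proof (cases "card T = Suc n")
        case True
        have "(p(T := q T)) (T - {t}) = p (T - {t})" if "t \<in> T" for t
          using that by auto
        then have "koszul_chain f v T p' \<longleftrightarrow> koszul_chain f v T (p(T := q T))"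
          using sub True by (intro koszul_chain_cong) (auto simp: p'_def)
        then show ?thesis
          using q T True by simp
      next
        case False
        then have "koszul_chain f v T p' \<longleftrightarrow> koszul_chain f v T p"
          using sub by (intro koszul_chain_cong) (auto simp: p'_def)
        then show ?thesis
          using p T False by simp
      qed
    qed
    then show ?case
      by blast
  qed
  from this[of "card U"] obtain p where p: "\<forall>T\<subseteq>U. card T \<le> card U \<longrightarrow> koszul_chain f v T p" ..
  show thesis
  proof (rule that)
    fix T assume "T \<subseteq> U"
    then show "koszul_chain f v T p"
      using p card_mono[OF U, of T] by simp
  qed
qed

text \<open>Removing one leaf t at a time: the coefficient that survives at T - {t} enters the
  boundary of T without cancellation. A basis element producing it has degree strictly above
  \<open>insert v (T - {t})\<close> and inside \<open>insert v T\<close>.\<close>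

lemma koszul_chain_nonzero:
  assumes U: "finite U" "v \<notin> U" and p: "\<And>T. T \<subseteq> U \<Longrightarrow> koszul_chain f v T p"
    and \<Gamma>: "\<And>e. e \<in> \<Gamma> \<Longrightarrow> card e = 2" and T: "T \<subseteq> U" "card T = Suc n"
  shows "\<exists>b\<in>B (Suc n). \<sigma> (Suc n) b = insert v T \<and> p T b \<noteq> 0"
  using T
proof (induction n arbitrary: T)
  case 0
  then obtain t where t: "T = {t}"
    using card_1_singletonE by auto
  have "t \<noteq> v"
    using t 0 U by auto
  have chain: "koszul_chain f v {t} p" "koszul_chain f v {} p"
    using t 0 p by auto
  then have "p {} 0 = 1"
    by (simp add: koszul_chain_def)
  then have "(\<Sum>b\<in>B 1. c 0 0 b * p T b) = koszul_sign f t T"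
    using chain(1) by (simp add: koszul_chain_def basis_0 t)
  also have "\<dots> \<noteq> 0"
    by (simp add: koszul_sign_def)
  finally obtain b where "b \<in> B 1" "c 0 0 b * p T b \<noteq> 0"
    by (rule sum.not_neutral_contains_not_neutral)
  then have b: "b \<in> B 1" "c 0 0 b \<noteq> 0" "p T b \<noteq> 0"
    by auto
  have sub: "\<sigma> 1 b \<subseteq> {v, t}"
    using chain(1) b by (auto simp: koszul_chain_def t)
  obtain e where e: "e \<in> \<Gamma>" "e \<subseteq> \<sigma> 1 b"
    using augmentation[of "\<sigma> 1 b"] b by blast
  \<comment> \<open>\<open>\<sigma> 1 b\<close> contains an edge and lies in {v, t}, so cardinality
    leaves no choice.\<close>
  have "e = {v, t}"
    using \<Gamma>[OF e(1)] e(2) sub \<open>t \<noteq> v\<close> by (intro card_subset_eq) auto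
  then have "\<sigma> 1 b = insert v T"
    using e(2) sub by (simp add: t subset_antisym)
  then show ?case
    using b by auto
next
  case (Suc n)
  have fin: "finite T"
    using Suc.prems(1) U(1) by (rule finite_subset)
  obtain t where t: "t \<in> T"
    using Suc.prems by fastforce
  let ?T = "T - {t}"
  have card: "card ?T = Suc n"
    using Suc.prems t fin by simp
  then obtain a where a: "a \<in> B (Suc n)" "\<sigma> (Suc n) a = insert v ?T" "p ?T a \<noteq> 0"
    using Suc.IH[of ?T] Suc.prems(1) by blast
  \<comment> \<open>The degree of \<open>a\<close> contains u, which the facet T - {u} lacks, so
    only T - {t} contributes at \<open>a\<close>.\<close>
  have "p (T - {u}) a = 0" if u: "u \<in> T" "u \<noteq> t" for u
  proof (rule ccontr)
    assume nz: "p (T - {u}) a \<noteq> 0"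
    have "koszul_chain f v (T - {u}) p"
      using Suc.prems(1) by (intro p) auto
    moreover have "card (T - {u}) = Suc n"
      using Suc.prems(2) fin u by simp
    ultimately have "\<sigma> (Suc n) a \<subseteq> insert v (T - {u})"
      using a(1) nz by (simp add: koszul_chain_def)
    then show False
      using a(2) u U(2) Suc.prems(1) by auto
  qed
  then have "(\<Sum>u\<in>T. koszul_sign f u T * p (T - {u}) a) = koszul_sign f t T * p ?T a"
    using t fin by (subst sum.remove[of _ t]) auto
  also have "\<dots> \<noteq> 0"
    using a(3) by (simp add: koszul_sign_def)
  finally have nz: "(\<Sum>u\<in>T. koszul_sign f u T * p (T - {u}) a) \<noteq> 0" .
  have chain: "koszul_chain f v T p"
    using p Suc.prems(1) .
  moreover have "T \<noteq> {}"
    using t by blast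
  ultimately have "(\<Sum>b\<in>B (Suc (Suc n)). c (Suc n) a b * p T b) \<noteq> 0"
    using a(1) nz Suc.prems(2) by (simp add: koszul_chain_def)
  then obtain b where b: "b \<in> B (Suc (Suc n))" "c (Suc n) a b * p T b \<noteq> 0"
    by (rule sum.not_neutral_contains_not_neutral)
  have "insert v ?T \<subset> \<sigma> (Suc (Suc n)) b"
    using degree_less[OF a(1) b(1)] b(2) a(2) by simp
  moreover have "\<sigma> (Suc (Suc n)) b \<subseteq> insert v T"
    using chain b Suc.prems(2) by (simp add: koszul_chain_def)
  ultimately have "\<sigma> (Suc (Suc n)) b = insert v T"
    by blast
  then show ?case
    using b by auto
qed

text \<open>The top of the Koszul complex, T = U. Steps count from R, so for the ideal this basis
  element has homological index card U - 1.\<close>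

lemma star_degree:
  assumes "finite (UNIV :: 'v set)" and "\<And>e. e \<in> \<Gamma> \<Longrightarrow> card e = 2"
    and "U \<noteq> {}" and star: "\<And>t. t \<in> U \<Longrightarrow> {v, t} \<in> \<Gamma>"
  shows "\<exists>b\<in>B (card U). \<sigma> (card U) b = insert v U"
proof -
  have U: "finite U"
    using assms(1) by (rule rev_finite_subset) simp
  obtain f :: "'v \<Rightarrow> nat" where f: "inj f"
    using finite_imp_inj_to_nat_seg[OF assms(1)] by blast
  have "v \<notin> U"
    using assms(2)[OF star[of v]] by auto
  obtain p where p: "\<And>T. T \<subseteq> U \<Longrightarrow> koszul_chain f v T p"
    using ex_koszul_chain[OF U f star] by blast
  obtain n where n: "card U = Suc n"
    using U assms(3) by (metis card_eq_0_iff not0_implies_Suc)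
  show ?thesis
    using koszul_chain_nonzero[OF U \<open>v \<notin> U\<close> p assms(2) subset_refl n] n by auto
qed

end

section \<open>From scalar data to polynomial matrices\<close>

definition squarefree_exp :: "'v::finite set \<Rightarrow> 'v \<Rightarrow>\<^sub>0 nat" where
  "squarefree_exp S = Abs_poly_mapping (\<lambda>v. if v \<in> S then 1 else 0)"

lemma lookup_squarefree_exp [simp]:
  "Poly_Mapping.lookup (squarefree_exp S) v = (if v \<in> S then 1 else 0)"
  by (simp add: squarefree_exp_def)

lemma keys_squarefree_exp [simp]: "Poly_Mapping.keys (squarefree_exp S) = S"
  by (auto simp: in_keys_iff split: if_splits)

lemma total_degree_squarefree_exp: "total_degree (squarefree_exp S) = card S"
  by (simp add: total_degree_def)

lemma squarefree_exp_empty [simp]: "squarefree_exp {} = 0"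
  by (rule poly_mapping_eqI) simp

lemma minus_squarefree_exp_add:
  "S \<subseteq> Poly_Mapping.keys w \<Longrightarrow> w - squarefree_exp S + squarefree_exp S = w"
  by (rule poly_mapping_eqI) (auto simp: lookup_add lookup_minus in_keys_iff subset_iff)

lemma keys_add_exp:
  "Poly_Mapping.keys (s + t :: 'v \<Rightarrow>\<^sub>0 nat) = Poly_Mapping.keys s \<union> Poly_Mapping.keys t"
  by (auto simp: in_keys_iff lookup_add)

text \<open>The coordinate, in multidegree \<open>w\<close>, of a coefficient \<open>q\<close> of a basis element of squarefree
  degree \<open>S\<close>.\<close>

definition strand :: "'v::finite set \<Rightarrow> ('v \<Rightarrow>\<^sub>0 nat) \<Rightarrow> ('v, 'k::comm_ring_1) mpoly \<Rightarrow> 'k" where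
  "strand S w q = (if S \<subseteq> Poly_Mapping.keys w then Poly_Mapping.lookup q (w - squarefree_exp S) else 0)"

lemma strand_add: "strand S (u + squarefree_exp S) q = Poly_Mapping.lookup q u"
  by (simp add: strand_def keys_add_exp)

text \<open>In a fixed multidegree, multiplication by a monomial becomes multiplication by its
  scalar. Both sides vanish when the support of the multidegree does not contain
  \<open>T\<close>.\<close>

lemma lookup_monomial_mult:
  fixes q :: "('v::finite, 'k::comm_ring_1) mpoly"
  assumes "c \<noteq> 0 \<Longrightarrow> S \<subseteq> T"
  shows "Poly_Mapping.lookup (Poly_Mapping.single (squarefree_exp (T - S)) c * q) u =
    c * strand T (u + squarefree_exp S) q"
proof (cases "c = 0")
  case False
  then have ST: "S \<subseteq> T"
    using assms by blast
  show ?thesis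
  proof (cases "T \<subseteq> Poly_Mapping.keys (u + squarefree_exp S)")
    case True
    then have "T - S \<subseteq> Poly_Mapping.keys u"
      by (auto simp: keys_add_exp)
    then have u: "squarefree_exp (T - S) + (u - squarefree_exp (T - S)) = u"
      by (metis add.commute minus_squarefree_exp_add)
    have "u + squarefree_exp S - squarefree_exp T = u - squarefree_exp (T - S)"
      using ST by (intro poly_mapping_eqI) (auto simp: lookup_add lookup_minus)
    then show ?thesis
      using True lookup_single_mult[of "squarefree_exp (T - S)" c q "u - squarefree_exp (T - S)"]
      by (simp add: strand_def u)
  next
    case nsub: False
    have "u \<notin> Poly_Mapping.keys (Poly_Mapping.single (squarefree_exp (T - S)) c * q)"
    proof
      assume "u \<in> Poly_Mapping.keys (Poly_Mapping.single (squarefree_exp (T - S)) c * q)"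
      then obtain a b where "a \<in> Poly_Mapping.keys (Poly_Mapping.single (squarefree_exp (T - S)) c)"
        "u = a + b"
        by (rule keys_multE)
      then have "T - S \<subseteq> Poly_Mapping.keys u"
        by (auto simp: keys_add_exp split: if_splits)
      then show False
        using nsub by (auto simp: keys_add_exp)
    qed
    then show ?thesis
      using nsub by (simp add: strand_def in_keys_iff)
  qed
qed simp

lemma single_sum: "Poly_Mapping.single t (\<Sum>i\<in>A. f i) = (\<Sum>i\<in>A. Poly_Mapping.single t (f i))"
  for f :: "'a \<Rightarrow> 'b::comm_monoid_add"
  by (rule poly_mapping_eqI) (simp add: lookup_sum lookup_single when_def)

lemma single_in_irrelevant_ideal:
  fixes c :: "'k::comm_ring_1" and S :: "'v::finite set"
  assumes "c \<noteq> 0 \<Longrightarrow> S \<noteq> {}"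
  shows "Poly_Mapping.single (squarefree_exp S) c \<in> irrelevant_ideal"
proof -
  interpret Modules.module "(*) :: ('v, 'k) mpoly \<Rightarrow> _"
    by (rule module_mult)
  show ?thesis
  proof (cases "c = 0")
    case True
    then show ?thesis
      by (simp add: irrelevant_ideal_def ideal_gen_def span_zero)
  next
    case False
    then obtain x where x: "x \<in> S"
      using assms by blast
    have "squarefree_exp (S - {x}) + Poly_Mapping.single x 1 = squarefree_exp S"
      using x by (intro poly_mapping_eqI) (auto simp: lookup_add lookup_single when_def)
    then have "Poly_Mapping.single (squarefree_exp S) c =
        Poly_Mapping.single (squarefree_exp (S - {x})) c * (X x :: ('v, 'k) mpoly)"
      by (simp add: X_def mult_single)
    then show ?thesis
      unfolding irrelevant_ideal_def ideal_gen_def by (simp add: span_scale span_base)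
  qed
qed

definition monomial_ideal :: "'v set set \<Rightarrow> ('v, 'k::comm_ring_1) mpoly set" where
  "monomial_ideal \<Gamma> = {p. \<forall>t\<in>Poly_Mapping.keys p. \<exists>e\<in>\<Gamma>. e \<subseteq> Poly_Mapping.keys t}"

definition entry ::
  "(nat \<Rightarrow> nat \<Rightarrow> 'v::finite set) \<Rightarrow> (nat \<Rightarrow> nat \<Rightarrow> nat \<Rightarrow> 'k::comm_ring_1) \<Rightarrow> nat \<Rightarrow> nat \<Rightarrow> nat \<Rightarrow> ('v, 'k) mpoly"
where
  "entry \<sigma> c i a b = Poly_Mapping.single (squarefree_exp (\<sigma> (Suc i) b - \<sigma> i a)) (c i a b)"

lemma
  fixes \<Gamma> :: "'v::finite set set" and c :: "nat \<Rightarrow> nat \<Rightarrow> nat \<Rightarrow> 'k::field"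
  assumes "squarefree_resolution \<Gamma> B \<sigma> c"
  shows homogeneous_entry: "a \<in> B i \<Longrightarrow> b \<in> B (Suc i) \<Longrightarrow>
      homogeneous (int (card (\<sigma> (Suc i) b)) - int (card (\<sigma> i a))) (entry \<sigma> c i a b)"
    and entry_irrelevant: "a \<in> B i \<Longrightarrow> b \<in> B (Suc i) \<Longrightarrow> entry \<sigma> c i a b \<in> irrelevant_ideal"
    and lookup_entry_sum: "a \<in> B i \<Longrightarrow>
      Poly_Mapping.lookup (\<Sum>b\<in>B (Suc i). entry \<sigma> c i a b * Y b) u =
      (\<Sum>b\<in>B (Suc i). c i a b * strand (\<sigma> (Suc i) b) (u + squarefree_exp (\<sigma> i a)) (Y b))"
    and entry_complex: "a \<in> B i \<Longrightarrow> d \<in> B (Suc (Suc i)) \<Longrightarrow>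
      (\<Sum>b\<in>B (Suc i). entry \<sigma> c i a b * entry \<sigma> c (Suc i) b d) = 0"
proof -
  interpret squarefree_resolution \<Gamma> B \<sigma> c by fact
  show "homogeneous (int (card (\<sigma> (Suc i) b)) - int (card (\<sigma> i a))) (entry \<sigma> c i a b)"
    if "a \<in> B i" "b \<in> B (Suc i)"
    using degree_less[OF that]
    by (auto simp: homogeneous_def entry_def total_degree_squarefree_exp card_Diff_subset
        card_mono of_nat_diff less_imp_le split: if_splits)
  show "entry \<sigma> c i a b \<in> irrelevant_ideal" if "a \<in> B i" "b \<in> B (Suc i)"
    unfolding entry_def using degree_less[OF that] by (intro single_in_irrelevant_ideal) blast
  show "Poly_Mapping.lookup (\<Sum>b\<in>B (Suc i). entry \<sigma> c i a b * Y b) u =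
      (\<Sum>b\<in>B (Suc i). c i a b * strand (\<sigma> (Suc i) b) (u + squarefree_exp (\<sigma> i a)) (Y b))"
    if "a \<in> B i"
    unfolding lookup_sum entry_def
    by (intro sum.cong refl lookup_monomial_mult) (use degree_less that in blast)
  show "(\<Sum>b\<in>B (Suc i). entry \<sigma> c i a b * entry \<sigma> c (Suc i) b d) = 0"
    if ad: "a \<in> B i" "d \<in> B (Suc (Suc i))"
  proof -
    let ?t = "squarefree_exp (\<sigma> (Suc (Suc i)) d - \<sigma> i a)"
    have "entry \<sigma> c i a b * entry \<sigma> c (Suc i) b d = Poly_Mapping.single ?t (c i a b * c (Suc i) b d)"
      if b: "b \<in> B (Suc i)" for b
    proof (cases "c i a b * c (Suc i) b d = 0")
      case True
      then show ?thesis
        by (simp only: entry_def mult_single single_zero)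
    next
      case False
      then have "\<sigma> i a \<subseteq> \<sigma> (Suc i) b" "\<sigma> (Suc i) b \<subseteq> \<sigma> (Suc (Suc i)) d"
        using degree_less[OF ad(1) b] degree_less[OF b ad(2)] by auto
      then have "squarefree_exp (\<sigma> (Suc i) b - \<sigma> i a) +
          squarefree_exp (\<sigma> (Suc (Suc i)) d - \<sigma> (Suc i) b) = ?t"
        by (intro poly_mapping_eqI) (auto simp: lookup_add)
      then show ?thesis
        by (simp add: entry_def mult_single)
    qed
    then have "(\<Sum>b\<in>B (Suc i). entry \<sigma> c i a b * entry \<sigma> c (Suc i) b d) =
        Poly_Mapping.single ?t (\<Sum>b\<in>B (Suc i). c i a b * c (Suc i) b d)"
      by (simp add: single_sum)
    then show ?thesis
      by (simp add: complex[OF ad])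
  qed
qed

text \<open>A linear system with these monomial coefficients splits into one scalar system per
  multidegree. Only finitely many multidegrees occur in \<open>Y\<close>, so the scalar solutions
  assemble to polynomials.\<close>

lemma strandwise_lift:
  fixes \<Gamma> :: "'v::finite set set" and c :: "nat \<Rightarrow> nat \<Rightarrow> nat \<Rightarrow> 'k::field"
  assumes r: "squarefree_resolution \<Gamma> B \<sigma> c"
    and lift: "\<And>w. \<exists>Z. (\<forall>d\<in>B (Suc i). Z d \<noteq> 0 \<longrightarrow> \<sigma> (Suc i) d \<subseteq> Poly_Mapping.keys w) \<and>
      (\<forall>b\<in>B i. strand (\<sigma> i b) w (Y b) = (\<Sum>d\<in>B (Suc i). c i b d * Z d))"
  shows "\<exists>z. \<forall>b\<in>B i. Y b = (\<Sum>d\<in>B (Suc i). entry \<sigma> c i b d * z d)"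
proof -
  interpret squarefree_resolution \<Gamma> B \<sigma> c by fact
  let ?W = "{w. \<exists>b\<in>B i. strand (\<sigma> i b) w (Y b) \<noteq> 0}"
  have "?W \<subseteq> (\<Union>b\<in>B i. (\<lambda>t. t + squarefree_exp (\<sigma> i b)) ` Poly_Mapping.keys (Y b))"
  proof
    fix w assume "w \<in> ?W"
    then obtain b where b: "b \<in> B i" "strand (\<sigma> i b) w (Y b) \<noteq> 0"
      by blast
    then have "w - squarefree_exp (\<sigma> i b) \<in> Poly_Mapping.keys (Y b)"
      "w = w - squarefree_exp (\<sigma> i b) + squarefree_exp (\<sigma> i b)"
      by (auto simp: strand_def in_keys_iff minus_squarefree_exp_add split: if_splits)
    then show "w \<in> (\<Union>b\<in>B i. (\<lambda>t. t + squarefree_exp (\<sigma> i b)) ` Poly_Mapping.keys (Y b))"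
      using b(1) by blast
  qed
  then have finW: "finite ?W"
    by (rule finite_subset) (simp add: finite_basis)
  define lifts where "lifts w Z \<longleftrightarrow>
      (\<forall>d\<in>B (Suc i). Z d \<noteq> 0 \<longrightarrow> \<sigma> (Suc i) d \<subseteq> Poly_Mapping.keys w) \<and>
      (\<forall>b\<in>B i. strand (\<sigma> i b) w (Y b) = (\<Sum>d\<in>B (Suc i). c i b d * Z d))" for w Z
  \<comment> \<open>Taking 0 wherever \<open>Y\<close> vanishes gives the assembled coefficients
    finite support.\<close>
  define Z where "Z w = (if w \<in> ?W then SOME Z. lifts w Z else (\<lambda>_. 0))" for w
  have Z0: "Z w = (\<lambda>_. 0)" if "w \<notin> ?W" for w
    using that unfolding Z_def by (rule if_not_P)
  have "lifts w (Z w)" for w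
  proof (cases "w \<in> ?W")
    case True
    have "\<exists>Z. lifts w Z"
      unfolding lifts_def by (rule lift)
    then have "lifts w (SOME Z. lifts w Z)"
      by (rule someI_ex)
    also have "(SOME Z. lifts w Z) = Z w"
      using True unfolding Z_def by (rule if_P[symmetric])
    finally show ?thesis .
  next
    case False
    then have "lifts w (\<lambda>_. 0)"
      by (simp add: lifts_def)
    then show ?thesis
      by (simp only: Z0[OF False])
  qed
  then have Z: "d \<in> B (Suc i) \<Longrightarrow> Z w d \<noteq> 0 \<Longrightarrow> \<sigma> (Suc i) d \<subseteq> Poly_Mapping.keys w"
    "b \<in> B i \<Longrightarrow> strand (\<sigma> i b) w (Y b) = (\<Sum>d\<in>B (Suc i). c i b d * Z w d)" for w d b
    by (simp_all add: lifts_def)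
  define z where "z d = Abs_poly_mapping (\<lambda>u. Z (u + squarefree_exp (\<sigma> (Suc i) d)) d)" for d
  have lookup_z: "Poly_Mapping.lookup (z d) u = Z (u + squarefree_exp (\<sigma> (Suc i) d)) d" for d u
  proof -
    have "{u. Z (u + squarefree_exp (\<sigma> (Suc i) d)) d \<noteq> 0} \<subseteq>
        (\<lambda>u. u + squarefree_exp (\<sigma> (Suc i) d)) -` ?W"
    proof
      fix u assume u: "u \<in> {u. Z (u + squarefree_exp (\<sigma> (Suc i) d)) d \<noteq> 0}"
      have "u + squarefree_exp (\<sigma> (Suc i) d) \<in> ?W"
      proof (rule ccontr)
        assume "u + squarefree_exp (\<sigma> (Suc i) d) \<notin> ?W"
        from Z0[OF this] u show False
          by simp
      qed
      then show "u \<in> (\<lambda>u. u + squarefree_exp (\<sigma> (Suc i) d)) -` ?W"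
        by (rule vimageI2)
    qed
    then have "finite {u. Z (u + squarefree_exp (\<sigma> (Suc i) d)) d \<noteq> 0}"
      by (rule finite_subset) (intro finite_vimageI finW injI, simp)
    then show ?thesis
      by (simp add: z_def)
  qed
  have strand_z: "strand (\<sigma> (Suc i) d) w (z d) = Z w d" if "d \<in> B (Suc i)" for d w
    using Z(1)[OF that, of w] by (auto simp: strand_def lookup_z minus_squarefree_exp_add)
  have "Y b = (\<Sum>d\<in>B (Suc i). entry \<sigma> c i b d * z d)" if b: "b \<in> B i" for b
  proof (rule poly_mapping_eqI)
    fix u
    have "Poly_Mapping.lookup (Y b) u = strand (\<sigma> i b) (u + squarefree_exp (\<sigma> i b)) (Y b)"
      by (simp add: strand_add)
    also have "\<dots> = Poly_Mapping.lookup (\<Sum>d\<in>B (Suc i). entry \<sigma> c i b d * z d) u"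
      by (simp add: lookup_entry_sum[OF r b] Z(2)[OF b] strand_z cong: sum.cong)
    finally show "Poly_Mapping.lookup (Y b) u =
        Poly_Mapping.lookup (\<Sum>d\<in>B (Suc i). entry \<sigma> c i b d * z d) u" .
  qed
  then show ?thesis
    by blast
qed

text \<open>In multidegree w the complex is the scalar complex for the support of w, which is exact
  by the locale.\<close>

lemma entry_exact:
  fixes \<Gamma> :: "'v::finite set set" and c :: "nat \<Rightarrow> nat \<Rightarrow> nat \<Rightarrow> 'k::field"
  assumes r: "squarefree_resolution \<Gamma> B \<sigma> c"
  shows "(\<forall>a\<in>B i. (\<Sum>b\<in>B (Suc i). entry \<sigma> c i a b * Y b) = 0) \<longleftrightarrow>
    (\<exists>z. \<forall>b\<in>B (Suc i). Y b = (\<Sum>d\<in>B (Suc (Suc i)). entry \<sigma> c (Suc i) b d * z d))"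
proof
  interpret squarefree_resolution \<Gamma> B \<sigma> c by fact
  assume Y: "\<forall>a\<in>B i. (\<Sum>b\<in>B (Suc i). entry \<sigma> c i a b * Y b) = 0"
  show "\<exists>z. \<forall>b\<in>B (Suc i). Y b = (\<Sum>d\<in>B (Suc (Suc i)). entry \<sigma> c (Suc i) b d * z d)"
  proof (rule strandwise_lift[OF r])
    fix w
    show "\<exists>Z. (\<forall>d\<in>B (Suc (Suc i)). Z d \<noteq> 0 \<longrightarrow> \<sigma> (Suc (Suc i)) d \<subseteq> Poly_Mapping.keys w) \<and>
      (\<forall>b\<in>B (Suc i). strand (\<sigma> (Suc i) b) w (Y b) =
        (\<Sum>d\<in>B (Suc (Suc i)). c (Suc i) b d * Z d))"
    proof (rule exact)
      fix a assume a: "a \<in> B i"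
      show "(\<Sum>b\<in>B (Suc i). c i a b * strand (\<sigma> (Suc i) b) w (Y b)) = 0"
      proof (cases "\<sigma> i a \<subseteq> Poly_Mapping.keys w")
        case True
        have "Poly_Mapping.lookup (\<Sum>b\<in>B (Suc i). entry \<sigma> c i a b * Y b)
            (w - squarefree_exp (\<sigma> i a)) = 0"
          using Y a by simp
        then show ?thesis
          by (simp add: lookup_entry_sum[OF r a] minus_squarefree_exp_add[OF True])
      next
        \<comment> \<open>This row has nonzero entries only in columns of larger degree, and their
          strands in w vanish as well.\<close>
        case False
        then show ?thesis
          using degree_less[OF a] by (intro sum.neutral) (force simp: strand_def)
      qed
    qed (auto simp: strand_def split: if_splits)
  qed
next
  assume "\<exists>z. \<forall>b\<in>B (Suc i). Y b = (\<Sum>d\<in>B (Suc (Suc i)). entry \<sigma> c (Suc i) b d * z d)"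
  then obtain z where z: "\<forall>b\<in>B (Suc i). Y b = (\<Sum>d\<in>B (Suc (Suc i)). entry \<sigma> c (Suc i) b d * z d)"
    by blast
  show "\<forall>a\<in>B i. (\<Sum>b\<in>B (Suc i). entry \<sigma> c i a b * Y b) = 0"
  proof
    fix a assume a: "a \<in> B i"
    have "(\<Sum>b\<in>B (Suc i). entry \<sigma> c i a b * Y b) =
        (\<Sum>b\<in>B (Suc i). \<Sum>d\<in>B (Suc (Suc i)). entry \<sigma> c i a b * entry \<sigma> c (Suc i) b d * z d)"
      using z by (simp add: sum_distrib_left mult.assoc cong: sum.cong)
    also have "\<dots> = (\<Sum>d\<in>B (Suc (Suc i)). (\<Sum>b\<in>B (Suc i). entry \<sigma> c i a b * entry \<sigma> c (Suc i) b d) * z d)"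
      by (subst sum.swap) (simp add: sum_distrib_right)
    also have "\<dots> = 0"
      using entry_complex[OF r a] by simp
    finally show "(\<Sum>b\<in>B (Suc i). entry \<sigma> c i a b * Y b) = 0" .
  qed
qed

text \<open>Exactness at R. Its strands are one-dimensional, so a single basis element with nonzero
  entry reaches each term of \<open>p\<close>.\<close>

lemma entry_augmentation:
  fixes \<Gamma> :: "'v::finite set set" and c :: "nat \<Rightarrow> nat \<Rightarrow> nat \<Rightarrow> 'k::field"
  assumes r: "squarefree_resolution \<Gamma> B \<sigma> c"
  shows "p \<in> monomial_ideal \<Gamma> \<longleftrightarrow> (\<exists>z. p = (\<Sum>d\<in>B 1. entry \<sigma> c 0 0 d * z d))"
proof
  interpret squarefree_resolution \<Gamma> B \<sigma> c by fact
  assume p: "p \<in> monomial_ideal \<Gamma>"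
  have "\<exists>z. \<forall>b\<in>B 0. p = (\<Sum>d\<in>B (Suc 0). entry \<sigma> c 0 b d * z d)"
  proof (rule strandwise_lift[OF r])
    fix w
    have "\<exists>Z. (\<forall>d\<in>B 1. Z d \<noteq> 0 \<longrightarrow> \<sigma> 1 d \<subseteq> Poly_Mapping.keys w) \<and>
        Poly_Mapping.lookup p w = (\<Sum>d\<in>B 1. c 0 0 d * Z d)"
    proof (cases "w \<in> Poly_Mapping.keys p")
      case True
      then obtain b where b: "b \<in> B 1" "\<sigma> 1 b \<subseteq> Poly_Mapping.keys w" "c 0 0 b \<noteq> 0"
        using p augmentation[of "Poly_Mapping.keys w"] by (auto simp: monomial_ideal_def)
      then show ?thesis
        using finite_basis
        by (intro exI[of _ "\<lambda>d. if d = b then Poly_Mapping.lookup p w / c 0 0 b else 0"])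
          (auto simp: if_distrib[of "\<lambda>x. _ * x"] cong: if_cong)
    next
      case False
      then show ?thesis
        by (intro exI[of _ "\<lambda>_. 0"]) (auto simp: in_keys_iff)
    qed
    then show "\<exists>Z. (\<forall>d\<in>B (Suc 0). Z d \<noteq> 0 \<longrightarrow> \<sigma> (Suc 0) d \<subseteq> Poly_Mapping.keys w) \<and>
        (\<forall>b\<in>B 0. strand (\<sigma> 0 b) w p = (\<Sum>d\<in>B (Suc 0). c 0 b d * Z d))"
      by (simp add: basis_0 degree_0 strand_def)
  qed
  then show "\<exists>z. p = (\<Sum>d\<in>B 1. entry \<sigma> c 0 0 d * z d)"
    by (simp add: basis_0)
next
  interpret squarefree_resolution \<Gamma> B \<sigma> c by fact
  assume "\<exists>z. p = (\<Sum>d\<in>B 1. entry \<sigma> c 0 0 d * z d)"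
  then obtain z where z: "p = (\<Sum>d\<in>B 1. entry \<sigma> c 0 0 d * z d)"
    by blast
  show "p \<in> monomial_ideal \<Gamma>"
    unfolding monomial_ideal_def
  proof (intro CollectI ballI)
    fix t assume "t \<in> Poly_Mapping.keys p"
    then obtain b where b: "b \<in> B 1" "t \<in> Poly_Mapping.keys (entry \<sigma> c 0 0 b * z b)"
      using keys_sum[of "\<lambda>d. entry \<sigma> c 0 0 d * z d" "B 1"] unfolding z by blast
    from b(2) obtain s u where "s \<in> Poly_Mapping.keys (entry \<sigma> c 0 0 b)" "t = s + u"
      by (rule keys_multE)
    then have "c 0 0 b \<noteq> 0" "\<sigma> 1 b \<subseteq> Poly_Mapping.keys t"
      by (auto simp: entry_def degree_0 keys_add_exp split: if_splits)
    then show "\<exists>e\<in>\<Gamma>. e \<subseteq> Poly_Mapping.keys t"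
      using augmentation b(1) by blast
  qed
qed

text \<open>A basis element of squarefree degree S becomes a generator of degree card S.
  \<open>D i\<close> is read off step i + 1 of the scalar data, because step 0 is R.\<close>

lemma ex_minimal_graded_free_resolution:
  fixes \<Gamma> :: "'v::finite set set" and c :: "nat \<Rightarrow> nat \<Rightarrow> nat \<Rightarrow> 'k::field"
  assumes r: "squarefree_resolution \<Gamma> B \<sigma> c"
  obtains D g A where
    "minimal_graded_free_resolution (monomial_ideal \<Gamma> :: ('v, 'k) mpoly set) D g A"
    "\<And>i j. count_list (D i) j = card {b \<in> B (Suc i). int (card (\<sigma> (Suc i) b)) = j}"
proof -
  interpret squarefree_resolution \<Gamma> B \<sigma> c by fact
  define bs where "bs i = sorted_list_of_set (B i)" for i
  define n where "n i = length (bs i)" for i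
  have bs: "distinct (bs i)" "set (bs i) = B i" for i
    using finite_basis by (simp_all add: bs_def)
  have bs_in: "bs i ! l \<in> B i" if "l < n i" for i l
    using nth_mem[of l "bs i"] that by (simp add: n_def bs(2))
  have bij: "bij_betw ((!) (bs i)) {..<n i} (B i)" for i
    by (rule bij_betw_nth) (simp_all add: bs n_def)
  define vec_of :: "nat \<Rightarrow> (nat \<Rightarrow> ('v, 'k) mpoly) \<Rightarrow> ('v, 'k) mpoly vec"
    where "vec_of i Y = vec (n i) (\<lambda>l. Y (bs i ! l))" for i Y
  have vec_of_carrier: "vec_of i Y \<in> carrier_vec (n i)" for i Y
    by (simp add: vec_of_def)
  have vec_of_eq: "vec_of i Y = vec_of i Y' \<longleftrightarrow> (\<forall>b\<in>B i. Y b = Y' b)" for i Y Y'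
  proof -
    have "vec_of i Y = vec_of i Y' \<longleftrightarrow> (\<forall>l\<in>{..<n i}. Y (bs i ! l) = Y' (bs i ! l))"
      by (auto simp: vec_of_def vec_eq_iff)
    also have "\<dots> \<longleftrightarrow> (\<forall>b\<in>(!) (bs i) ` {..<n i}. Y b = Y' b)"
      by blast
    also have "(!) (bs i) ` {..<n i} = B i"
      using bij[of i] by (simp add: bij_betw_def)
    finally show ?thesis .
  qed
  have vec_of_surj: "\<exists>Y. y = vec_of i Y" if "y \<in> carrier_vec (n i)" for y i
    using that bij_betw_imp_inj_on[OF bij, of i]
    by (intro exI[of _ "\<lambda>b. y $ the_inv_into {..<n i} ((!) (bs i)) b"])
      (auto simp: vec_of_def the_inv_into_f_f vec_eq_iff)
  have carrier_vec_of: "carrier_vec (n i) = range (vec_of i)" for i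
    using vec_of_carrier vec_of_surj by blast
  have sum_bs: "(\<Sum>l<n i. f (bs i ! l)) = (\<Sum>b\<in>B i. f b)"
    for i and f :: "nat \<Rightarrow> ('v, 'k) mpoly"
    by (rule sum.reindex_bij_betw[OF bij])
  define D where "D i = map (\<lambda>b. int (card (\<sigma> (Suc i) b))) (bs (Suc i))" for i
  define g where "g = vec_of (Suc 0) (entry \<sigma> c 0 0)"
  define A where "A i = mat (n (Suc i)) (n (Suc (Suc i)))
    (\<lambda>(x, y). entry \<sigma> c (Suc i) (bs (Suc i) ! x) (bs (Suc (Suc i)) ! y))" for i
  have len: "length (D i) = n (Suc i)" for i
    by (simp add: D_def n_def)
  have dim: "dim_row (A i) = n (Suc i)" "dim_col (A i) = n (Suc (Suc i))" for i
    by (simp_all add: A_def)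
  have g_mult: "g \<bullet> vec_of (Suc 0) Y = (\<Sum>b\<in>B (Suc 0). entry \<sigma> c 0 0 b * Y b)" for Y
    unfolding sum_bs[symmetric]
    by (auto simp: g_def vec_of_def scalar_prod_def atLeast0LessThan intro!: sum.cong)
  have A_mult: "A i *\<^sub>v vec_of (Suc (Suc i)) Y =
      vec_of (Suc i) (\<lambda>a. \<Sum>b\<in>B (Suc (Suc i)). entry \<sigma> c (Suc i) a b * Y b)" for i Y
    unfolding sum_bs[symmetric]
    by (auto simp: A_def vec_of_def scalar_prod_def atLeast0LessThan vec_eq_iff intro!: sum.cong)
  have vec_of_0: "0\<^sub>v (n i) = vec_of i (\<lambda>_. 0)" for i
    by (auto simp: vec_of_def vec_eq_iff)
  have image: "vec_of (Suc i) Y \<in> mat_image (A i) \<longleftrightarrow>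
      (\<exists>z. \<forall>b\<in>B (Suc i). Y b = (\<Sum>d\<in>B (Suc (Suc i)). entry \<sigma> c (Suc i) b d * z d))" for i Y
  proof -
    have "vec_of (Suc i) Y \<in> mat_image (A i) \<longleftrightarrow> (\<exists>z. vec_of (Suc i) Y = A i *\<^sub>v vec_of (Suc (Suc i)) z)"
      unfolding mat_image_def dim carrier_vec_of by blast
    then show ?thesis
      by (simp add: A_mult vec_of_eq)
  qed
  have image_carrier: "mat_image (A i) \<subseteq> carrier_vec (n (Suc i))" for i
    by (auto simp: mat_image_def dim intro!: carrier_vecI)
  have "minimal_graded_free_resolution (monomial_ideal \<Gamma>) D g A"
    unfolding minimal_graded_free_resolution_def
  proof (intro conjI allI impI)
    show "g \<in> carrier_vec (length (D 0))"
      by (simp add: g_def len vec_of_carrier)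
  next
    fix b assume "b < length (D 0)"
    then show "homogeneous (D 0 ! b) (g $ b)"
      using homogeneous_entry[OF r, of 0 0 "bs (Suc 0) ! b"] bs_in[of b "Suc 0"]
      by (simp add: D_def g_def vec_of_def basis_0 degree_0 n_def)
  next
    fix i
    show "graded_matrix (D (Suc i)) (D i) (A i)"
      unfolding graded_matrix_def
    proof (intro conjI allI impI)
      show "A i \<in> carrier_mat (length (D i)) (length (D (Suc i)))"
        by (simp add: A_def len)
      fix a b assume "a < length (D i)" "b < length (D (Suc i))"
      then show "homogeneous (D (Suc i) ! b - D i ! a) (A i $$ (a, b))"
        using homogeneous_entry[OF r bs_in bs_in, of a "Suc i" b]
        by (simp add: A_def len) (simp add: D_def n_def)
    qed
  next
    show "{g \<bullet> y |y. y \<in> carrier_vec (length (D 0))} = monomial_ideal \<Gamma>"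
    proof -
      have "{g \<bullet> y |y. y \<in> carrier_vec (length (D 0))} = {g \<bullet> vec_of (Suc 0) Y | Y. True}"
        unfolding len carrier_vec_of by blast
      then show ?thesis
        unfolding g_mult set_eq_iff entry_augmentation[OF r] One_nat_def by simp
    qed
  next
    show "{y \<in> carrier_vec (length (D 0)). g \<bullet> y = 0} = mat_image (A 0)"
    proof (intro equalityI subsetI)
      fix y assume "y \<in> {y \<in> carrier_vec (length (D 0)). g \<bullet> y = 0}"
      then obtain Y where "y = vec_of (Suc 0) Y" "g \<bullet> vec_of (Suc 0) Y = 0"
        by (auto simp: len carrier_vec_of)
      then show "y \<in> mat_image (A 0)"
        using entry_exact[OF r, of 0 Y] image[of 0 Y] by (simp add: g_mult basis_0)
    next
      fix y assume y: "y \<in> mat_image (A 0)"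
      then obtain Y where Y: "y = vec_of (Suc 0) Y"
        using image_carrier[of 0] by (auto simp: carrier_vec_of)
      then show "y \<in> {y \<in> carrier_vec (length (D 0)). g \<bullet> y = 0}"
        using y entry_exact[OF r, of 0 Y] image[of 0 Y]
        by (simp add: len vec_of_carrier g_mult basis_0)
    qed
  next
    fix i
    have "vec_of (Suc (Suc i)) Y \<in> mat_kernel (A i) \<longleftrightarrow> vec_of (Suc (Suc i)) Y \<in> mat_image (A (Suc i))" for Y
      unfolding image entry_exact[OF r, symmetric]
      by (simp add: mat_kernel_def dim vec_of_carrier A_mult vec_of_0 vec_of_eq)
    moreover have "mat_kernel (A i) \<subseteq> carrier_vec (n (Suc (Suc i)))"
      by (auto simp: mat_kernel_def dim)
    ultimately show "mat_kernel (A i) = mat_image (A (Suc i))"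
      using image_carrier[of "Suc i"] unfolding carrier_vec_of by blast
  next
    fix i
    show "elements_mat (A i) \<subseteq> irrelevant_ideal"
      using entry_irrelevant[OF r bs_in bs_in] by (auto simp: A_def elements_mat_def)
  qed
  moreover have "count_list (D i) j = card {b \<in> B (Suc i). int (card (\<sigma> (Suc i) b)) = j}" for i j
  proof -
    have "count_list (D i) j = length (filter (\<lambda>b. int (card (\<sigma> (Suc i) b)) = j) (bs (Suc i)))"
      by (simp add: D_def count_list_eq_length_filter filter_map o_def eq_commute)
    also have "\<dots> = card (set (filter (\<lambda>b. int (card (\<sigma> (Suc i) b)) = j) (bs (Suc i))))"
      by (rule distinct_card[OF distinct_filter[OF bs(1)], symmetric])
    finally show ?thesis
      by (simp add: bs)
  qed
  ultimately show thesis
    by (rule that)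
qed

section \<open>Edge ideals\<close>

text \<open>Two-element edges exclude generators \<open>X x * X x\<close>, so every generator is
  squarefree.\<close>

lemma edge_ideal_eq_monomial_ideal:
  fixes G :: "'v::finite graph"
  assumes "\<And>e. e \<in> edges G \<Longrightarrow> card e = 2"
  shows "edge_ideal G = (monomial_ideal (edges G) :: ('v, 'k::field) mpoly set)"
proof -
  interpret Modules.module "(*) :: ('v, 'k) mpoly \<Rightarrow> _"
    by (rule module_mult)
  let ?S = "{X x * X y | x y. {x, y} \<in> edges G} :: ('v, 'k) mpoly set"
  have XX: "X x * X y = (Poly_Mapping.single (squarefree_exp {x, y}) 1 :: ('v, 'k) mpoly)"
    if "{x, y} \<in> edges G" for x y
  proof -
    have "x \<noteq> y"
      using assms[OF that] by auto
    then have "Poly_Mapping.single x 1 + Poly_Mapping.single y 1 = squarefree_exp {x, y}"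
      by (intro poly_mapping_eqI) (auto simp: lookup_add lookup_single when_def)
    then show ?thesis
      by (simp add: X_def mult_single)
  qed
  have "span ?S \<subseteq> monomial_ideal (edges G)"
  proof (rule span_minimal)
    show "?S \<subseteq> monomial_ideal (edges G)"
      by (auto simp: monomial_ideal_def XX)
    show "subspace (monomial_ideal (edges G) :: ('v, 'k) mpoly set)"
      unfolding subspace_def
    proof (intro conjI ballI allI)
      fix p q :: "('v, 'k) mpoly"
      assume "p \<in> monomial_ideal (edges G)" "q \<in> monomial_ideal (edges G)"
      then show "p + q \<in> monomial_ideal (edges G)"
        using keys_add[of p q] by (auto simp: monomial_ideal_def)
    next
      fix p q :: "('v, 'k) mpoly"
      assume q: "q \<in> monomial_ideal (edges G)"
      show "p * q \<in> monomial_ideal (edges G)"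
        unfolding monomial_ideal_def
      proof (intro CollectI ballI)
        fix t assume "t \<in> Poly_Mapping.keys (p * q)"
        then obtain a b where "b \<in> Poly_Mapping.keys q" "t = a + b"
          by (rule keys_multE)
        moreover obtain e where "e \<in> edges G" "e \<subseteq> Poly_Mapping.keys b"
          using q calculation(1) by (auto simp: monomial_ideal_def)
        ultimately show "\<exists>e\<in>edges G. e \<subseteq> Poly_Mapping.keys t"
          by (intro bexI[of _ e]) (auto simp: keys_add_exp)
      qed
    qed (simp add: monomial_ideal_def)
  qed
  moreover have "p \<in> span ?S" if p: "p \<in> monomial_ideal (edges G)" for p
  proof -
    have "Poly_Mapping.single t a \<in> span ?S" if t: "t \<in> Poly_Mapping.keys p" for t a
    proof -
      obtain e where e: "e \<in> edges G" "e \<subseteq> Poly_Mapping.keys t"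
        using p t by (auto simp: monomial_ideal_def)
      obtain x y where xy: "e = {x, y}"
        using assms[OF e(1)] by (auto simp: card_2_iff)
      then have "Poly_Mapping.single t a =
          Poly_Mapping.single (t - squarefree_exp e) a * (X x * X y :: ('v, 'k) mpoly)"
        using XX e by (simp add: mult_single minus_squarefree_exp_add)
      moreover have "(X x * X y :: ('v, 'k) mpoly) \<in> ?S"
        using e xy by blast
      ultimately show ?thesis
        by (simp only: span_scale span_base)
    qed
    then have "(\<Sum>t\<in>Poly_Mapping.keys p. Poly_Mapping.single t (Poly_Mapping.lookup p t)) \<in> span ?S"
      by (intro span_sum)
    also have "(\<Sum>t\<in>Poly_Mapping.keys p. Poly_Mapping.single t (Poly_Mapping.lookup p t)) = p"
      by (rule poly_mapping_eqI) (auto simp: lookup_sum lookup_single when_def in_keys_iff)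
    finally show ?thesis .
  qed
  ultimately show ?thesis
    unfolding edge_ideal_def ideal_gen_def by blast
qed

section \<open>Betti numbers of squarefree monomial ideals and the bounds\<close>

lemma betti_monomial_ideal:
  fixes \<Gamma> :: "'v::finite set set" and c :: "nat \<Rightarrow> nat \<Rightarrow> nat \<Rightarrow> 'k::field"
  assumes "squarefree_resolution \<Gamma> B \<sigma> c"
  shows "betti (monomial_ideal \<Gamma> :: ('v, 'k) mpoly set) (int i) j =
    card {b \<in> B (Suc i). int (card (\<sigma> (Suc i) b)) = j}"
proof -
  obtain D g A where
    "minimal_graded_free_resolution (monomial_ideal \<Gamma> :: ('v, 'k) mpoly set) D g A"
    "\<And>i j. count_list (D i) j = card {b \<in> B (Suc i). int (card (\<sigma> (Suc i) b)) = j}"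
    using ex_minimal_graded_free_resolution[OF assms] by blast
  then show ?thesis
    by (simp add: betti_eq)
qed

text \<open>Needed for \<open>Max\<close>: homological index and degree are bounded by the number of
  variables, and the convention at -1 adds one pair.\<close>

lemma finite_betti_support:
  fixes \<Gamma> :: "'v::finite set set" and c :: "nat \<Rightarrow> nat \<Rightarrow> nat \<Rightarrow> 'k::field"
  assumes r: "squarefree_resolution \<Gamma> B \<sigma> c"
  shows "finite {(i, j). betti (monomial_ideal \<Gamma> :: ('v, 'k) mpoly set) i j \<noteq> 0}"
proof -
  interpret squarefree_resolution \<Gamma> B \<sigma> c by fact
  let ?n = "int (card (UNIV :: 'v set))"
  have "i \<le> ?n \<and> 0 \<le> j \<and> j \<le> ?n" if "betti (monomial_ideal \<Gamma> :: ('v, 'k) mpoly set) i j \<noteq> 0" "0 \<le> i" for i j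
  proof -
    obtain m where m: "i = int m"
      using \<open>0 \<le> i\<close> nonneg_int_cases by blast
    then have "card {b \<in> B (Suc m). int (card (\<sigma> (Suc m) b)) = j} \<noteq> 0"
      using that by (simp add: betti_monomial_ideal[OF r])
    then have "{b \<in> B (Suc m). int (card (\<sigma> (Suc m) b)) = j} \<noteq> {}"
      by (intro notI) simp
    then obtain b where b: "b \<in> B (Suc m)" "int (card (\<sigma> (Suc m) b)) = j"
      by blast
    moreover have "Suc m \<le> card (\<sigma> (Suc m) b)"
      using b by (intro card_degree_ge) auto
    moreover have "card (\<sigma> (Suc m) b) \<le> card (UNIV :: 'v set)"
      by (intro card_mono) auto
    ultimately show ?thesis
      using m by linarith
  qed
  moreover have "i = -1 \<and> j = 0"
    if "betti (monomial_ideal \<Gamma> :: ('v, 'k) mpoly set) i j \<noteq> 0" "\<not> 0 \<le> i" for i j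
    using that by (auto simp: betti_def split: if_splits)
  ultimately have "-1 \<le> i \<and> i \<le> ?n \<and> 0 \<le> j \<and> j \<le> ?n"
    if "betti (monomial_ideal \<Gamma> :: ('v, 'k) mpoly set) i j \<noteq> 0" for i j
    using that by (cases "0 \<le> i") fastforce+
  then have "{(i, j). betti (monomial_ideal \<Gamma> :: ('v, 'k) mpoly set) i j \<noteq> 0} \<subseteq> {-1..?n} \<times> {0..?n}"
    by (simp add: subset_iff)
  then show ?thesis
    by (rule finite_subset) simp
qed

text \<open>Restriction to \<open>W\<close> selects a subset of the same basis, with unchanged
  degrees.\<close>

lemma betti_restrict_le:
  fixes \<Gamma> :: "'v::finite set set"
  assumes r: "squarefree_resolution \<Gamma> B \<sigma> (c :: nat \<Rightarrow> nat \<Rightarrow> nat \<Rightarrow> 'k::field)"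
  shows "betti (monomial_ideal {e \<in> \<Gamma>. e \<subseteq> W} :: ('v, 'k) mpoly set) i j
    \<le> betti (monomial_ideal \<Gamma> :: ('v, 'k) mpoly set) i j"
proof (cases "0 \<le> i")
  case True
  then obtain m where m: "i = int m"
    using nonneg_int_cases by blast
  show ?thesis
    unfolding m betti_monomial_ideal[OF r]
      betti_monomial_ideal[OF squarefree_resolution.restrict[OF r]]
    using squarefree_resolution.finite_basis[OF r] by (intro card_mono) auto
qed (simp add: betti_def)

lemma betti_minus_one: "betti I (-1) 0 = 1"
  by (simp add: betti_def)

text \<open>Without edges the ideal is (0), whose regularity is 1 by the convention at index -1;
  hence the bound 2 presupposes an edge.\<close>

theorem corollary4p4:
  fixes G :: "'v::finite graph" and v :: 'v
  assumes "finite_simple_graph G" and "v \<in> verts G"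
  shows "(edges G \<noteq> {} \<longrightarrow>
            regularity (edge_ideal G :: ('v, 'k::field) mpoly set)
              \<ge> max 2 (regularity (edge_ideal (delete_vertex G v) :: ('v, 'k) mpoly set)))
       \<and> proj_dim (edge_ideal G :: ('v, 'k) mpoly set)
              \<ge> max (int (vertex_degree G v) - 1)
                    (proj_dim (edge_ideal (delete_vertex G v) :: ('v, 'k) mpoly set))"
proof -
  have card_edge: "card e = 2" if "e \<in> edges G" for e
    using assms(1) that by (simp add: finite_simple_graph_def)
  obtain B \<sigma> and c :: "nat \<Rightarrow> nat \<Rightarrow> nat \<Rightarrow> 'k" where r: "squarefree_resolution (edges G) B \<sigma> c"
  proof (rule ex_squarefree_resolution)
    show "{} \<notin> edges G"
      using card_edge[of "{}"] by auto
  qed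
  interpret squarefree_resolution "edges G" B \<sigma> c by fact
  let ?I = "edge_ideal G :: ('v, 'k) mpoly set"
  let ?J = "edge_ideal (delete_vertex G v) :: ('v, 'k) mpoly set"
  have I: "?I = monomial_ideal (edges G)"
    using card_edge by (rule edge_ideal_eq_monomial_ideal)
  have "edges (delete_vertex G v) = {e \<in> edges G. e \<subseteq> - {v}}"
    by (auto simp: delete_vertex_def)
  then have J: "?J = monomial_ideal {e \<in> edges G. e \<subseteq> - {v}}"
    using card_edge edge_ideal_eq_monomial_ideal[of "delete_vertex G v"] by auto
  have betti_I: "betti ?I (int i) j = card {b \<in> B (Suc i). int (card (\<sigma> (Suc i) b)) = j}" for i j
    unfolding I by (rule betti_monomial_ideal[OF r])
  have mono: "betti ?I i j \<noteq> 0" if "betti ?J i j \<noteq> 0" for i j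
    using that betti_restrict_le[OF r, of "- {v}" i j] by (simp add: I J)
  have betti_I_nonzero: "betti ?I (int i) (int (card (\<sigma> (Suc i) b))) \<noteq> 0" if "b \<in> B (Suc i)" for i b
    using that finite_basis[of "Suc i"] by (simp add: betti_I) blast
  have fin: "finite {(i, j). betti ?I i j \<noteq> 0}"
    unfolding I by (rule finite_betti_support[OF r])
  have reg: "finite {j - i | i j. betti ?I i j \<noteq> 0}"
    using finite_imageI[OF fin, of "\<lambda>(i, j). j - i"] by (rule rev_finite_subset) force
  have pd: "finite {i | i j. betti ?I i j \<noteq> 0}"
    using finite_imageI[OF fin, of fst] by (rule rev_finite_subset) force
  \<comment> \<open>\<open>Max_mono\<close> asks for a nonempty set; index -1 provides an element
    even if no edge survives the deletion.\<close>
  have nonzero: "\<exists>i j. betti ?J i j \<noteq> 0"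
    using betti_minus_one[of ?J] by (metis zero_neq_one)
  have "regularity ?J \<le> regularity ?I"
    unfolding regularity_def by (intro Max_mono reg) (use mono nonzero in blast)+
  moreover have "proj_dim ?J \<le> proj_dim ?I"
    unfolding proj_dim_def by (intro Max_mono pd) (use mono nonzero in blast)+
  \<comment> \<open>Some generator has degree inside a given edge e; this degree contains an edge
    itself, so it equals e and has cardinality 2.\<close>
  moreover have "2 \<le> regularity ?I" if nonempty: "edges G \<noteq> {}"
  proof -
    obtain e where e: "e \<in> edges G"
      using nonempty by blast
    then obtain b where b: "b \<in> B 1" "\<sigma> 1 b \<subseteq> e" "c 0 0 b \<noteq> 0"
      using augmentation[of e] by blast
    then obtain e' where "e' \<in> edges G" "e' \<subseteq> \<sigma> 1 b"
      using augmentation[of "\<sigma> 1 b"] by blast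
    then have "e' = e"
      using b(2) card_edge e by (intro card_subset_eq) auto
    then have "card (\<sigma> 1 b) = 2"
      using b(2) \<open>e' \<subseteq> _\<close> card_edge[OF e] by (simp add: subset_antisym)
    then have "betti ?I 0 2 \<noteq> 0"
      using betti_I_nonzero[of b 0] b(1) by simp
    then show ?thesis
      unfolding regularity_def by (intro Max_ge[OF reg]) force
  qed
  moreover have "int (vertex_degree G v) - 1 \<le> proj_dim ?I"
  proof -
    let ?U = "{t. {v, t} \<in> edges G}"
    have "{e \<in> edges G. v \<in> e} = (\<lambda>t. {v, t}) ` ?U"
    proof (intro equalityI subsetI)
      fix e assume e: "e \<in> {e \<in> edges G. v \<in> e}"
      then obtain x y where "e = {x, y}"
        using card_edge[of e] by (auto simp: card_2_iff)
      then show "e \<in> (\<lambda>t. {v, t}) ` ?U"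
        using e by (auto simp: insert_commute)
    qed auto
    moreover have "inj_on (\<lambda>t. {v, t}) ?U"
      by (auto simp: inj_on_def doubleton_eq_iff)
    ultimately have deg: "vertex_degree G v = card ?U"
      by (simp add: vertex_degree_def card_image)
    show ?thesis
    proof (cases "?U = {}")
      \<comment> \<open>For an isolated v the bound is -1, and the convention puts -1 into the set
        whose maximum is taken.\<close>
      case True
      then have "int (vertex_degree G v) - 1 = -1"
        by (simp add: deg)
      also have "\<dots> \<le> proj_dim ?I"
        unfolding proj_dim_def
      proof (rule Max_ge[OF pd])
        have "betti ?I (-1) 0 \<noteq> 0"
          by (simp add: betti_minus_one)
        then show "-1 \<in> {i | i j. betti ?I i j \<noteq> 0}"
          by blast
      qed
      finally show ?thesis .
    next
      case False
      have "\<exists>b\<in>B (card ?U). \<sigma> (card ?U) b = insert v ?U"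
      proof (rule star_degree)
        show "{v, t} \<in> edges G" if "t \<in> ?U" for t
          using that by simp
      qed (use card_edge False in simp_all)
      then obtain b where b: "b \<in> B (card ?U)"
        by blast
      have "card ?U \<noteq> 0"
        unfolding card_eq_0_iff using False finite[of ?U] by blast
      from not0_implies_Suc[OF this] obtain n where n: "card ?U = Suc n" ..
      \<comment> \<open>The basis element lies in step d counted from R, so its homological index is
        n = d - 1.\<close>
      have "int (vertex_degree G v) - 1 = int n"
        by (simp add: deg n)
      also have "\<dots> \<le> proj_dim ?I"
        unfolding proj_dim_def using betti_I_nonzero[of b n] b n
        by (intro Max_ge[OF pd]) auto
      finally show ?thesis .
    qed
  qed
  ultimately show ?thesis
    by simp
qed

end
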